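(* Let $C_m^1$ be the capacity with subcarrier collisions of the $m$th secondary user (SU) in the presence of a single ($n$th) primary user (PU), as defined in the context. Then $$\mathbb{E}\left[C_m^1\right]=\frac{F_m^S}{F}\left[F_n^P\left(\mathbb{E}\left[C_{m,i}^{I,n}\right]-\mathbb{E}\left[C_{m,i}^{NI}\right]\right)+F\,\mathbb{E}\left[C_{m,i}^{NI}\right]\right],$$ where $C_{m,i}^{I,n}$ and $C_{m,i}^{NI}$ are the $i$th subcarrier capacities of the $m$th SU with interference and with no interference from the $n$th PU, respectively. In the case of Rayleigh channel fading (i.e. $h_{m,i},h_{mp,i},g_{ns,i}$ are independent exponential random variables with mean $1$), these expectations are given by $$\mathbb{E}\left[C_{m,i}^{I,n}\right]=\frac{1-e^{-\Psi_i/P_{m,i}}}{1-P_{n,i}/P_{m,i}}\left(\Gamma\!\left(0,\tfrac{\eta}{P_{m,i}}\right)e^{\eta/P_{m,i}}-\Gamma\!\left(0,\tfrac{\eta}{P_{n,i}}\right)e^{\eta/P_{n,i}}\right)+\frac{\Psi_i}{P_{n,i}}e^{\eta/P_{n,i}}\int_0^\infty \Gamma\!\left(0,\left(\eta+\tfrac{\Psi_i}{x}\right)\left(\tfrac1{P_{n,i}}+\tfrac{x}{P_{m,i}}\right)\right)\frac{e^{\Psi_i/(xP_{n,i})}}{x(1+x)}\,dx,$$ $$\mathbb{E}\left[C_{m,i}^{NI}\right]=\Gamma\!\left(0,\tfrac{\eta}{P_{m,i}}\right)e^{\eta/P_{m,i}}\left(1+\frac{e^{-\Psi_i/P_{m,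i}}\,\eta}{\Psi_i-\eta}\right)+\frac{\Psi_i}{\eta-\Psi_i}\,\Gamma\!\left(0,\tfrac{\Psi_i}{P_{m,i}}\right).$$
   Context: Model. There are $F$ subcarriers, of which a fixed set of $F_n^P$ are used by the $n$th PU. The SU picks a set of $F_m^S$ of the $F$ subcarriers uniformly at random (without replacement). Let $k_{nm}$ be the number of picked subcarriers that are used by the PU (collisions) and $k_{fm}=F_m^S-k_{nm}$ the number of collision-free ones; $k_{nm}$ is hypergeometric. Per-subcarrier quantities: $P_{m,i},P_{n,i},\Psi_i,\eta>0$ are constants not depending on $i$ (SU peak transmit power, PU transmit power, interference temperature, noise variance). $h_{m,i},h_{mp,i},g_{ns,i}$ are independent positive random variables (channel power gains from the SU to its own base station, from the SU to the primary base station, and from the PU to the secondary base station; arbitrary distributions in the general-fading case), i.i.d. over the subcarrier index $i$. Set $\lambda_{m,i}=h_{m,i}\min\{P_{m,i},\Psi_i/h_{mp,i}\}$, $S_{m,i}^{I,n}=\lambda_{m,i}/(P_{n,i}g_{ns,i}+\eta)$ (SINR with interference), $S_{m,i}^{NI}=\lambda_{m,i}/\eta$ (no interference), $C_{m,i}^{I,n}=\log(1+S_{m,i}^{I,n})$ and $C_{m,i}^{NI}=\log(1+S_{m,i}^{NI})$ (natural logarithm). The variables $C_{m,i}^{I,n}$ are i.i.d. in $i$, and so are the $C_{m,i}^{NI}$; the random subcarrier choice is independent of the channel gains. The SU capacity with collisions is $$C_m^1=\sum_{i=1}^{k_{nm}}C_{m,i}^{I,n}+\sum_{i=1}^{k_{fm}}C_{m,i}^{NI}.$$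 The upper incomplete Gamma function is $\Gamma(x,y)=\int_y^\infty t^{x-1}e^{-t}\,dt$. *)

theory Defs
  imports "HOL-Probability.Probability"
begin

definition upper_Gamma :: "real \<Rightarrow> real \<Rightarrow> real" where
  "upper_Gamma x y = (LINT t:{y<..}|lborel. t powr (x - 1) * exp (- t))"

definition subcarrier_sets :: "nat \<Rightarrow> nat \<Rightarrow> nat set set" where
  "subcarrier_sets F s = {K. K \<subseteq> {1..F} \<and> card K = s}"

text \<open>
  The three kinds of channels: secondary user to its own base station (power gain \<open>h\<close>),
  secondary user to the primary base station (\<open>hmp\<close>), and primary user to the secondary
  base station (\<open>g\<close>). The type allows all gains to be gathered in a single family, indexed
  by a link and a subcarrier, whose joint independence can then be stated.
\<close>

datatype link = SU_SBS | SU_PBS | PU_SBS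

fun channel_gain ::
  "(nat \<Rightarrow> 'a \<Rightarrow> real) \<Rightarrow> (nat \<Rightarrow> 'a \<Rightarrow> real) \<Rightarrow> (nat \<Rightarrow> 'a \<Rightarrow> real) \<Rightarrow> link \<times> nat \<Rightarrow> 'a \<Rightarrow> real"
where
  "channel_gain h hmp g (SU_SBS, i) = h i"
| "channel_gain h hmp g (SU_PBS, i) = hmp i"
| "channel_gain h hmp g (PU_SBS, i) = g i"

text \<open>
  \<open>Pm\<close>, \<open>Pn\<close>, \<open>\<Psi>\<close>, \<open>\<eta>\<close> are the peak transmit power of the secondary user, the transmit power of
  the primary user, the interference temperature and the noise variance. The remaining real
  arguments are values of the channel power gains on one subcarrier.
\<close>

definition received_power :: "real \<Rightarrow> real \<Rightarrow> real \<Rightarrow> real \<Rightarrow> real" where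
  "received_power Pm \<Psi> h hmp = h * min Pm (\<Psi> / hmp)"

definition SINR_I :: "real \<Rightarrow> real \<Rightarrow> real \<Rightarrow> real \<Rightarrow> real \<Rightarrow> real \<Rightarrow> real \<Rightarrow> real" where
  "SINR_I Pm Pn \<Psi> \<eta> h hmp g = received_power Pm \<Psi> h hmp / (Pn * g + \<eta>)"

definition SNR_NI :: "real \<Rightarrow> real \<Rightarrow> real \<Rightarrow> real \<Rightarrow> real \<Rightarrow> real" where
  "SNR_NI Pm \<Psi> \<eta> h hmp = received_power Pm \<Psi> h hmp / \<eta>"

definition capacity_I :: "real \<Rightarrow> real \<Rightarrow> real \<Rightarrow> real \<Rightarrow> real \<Rightarrow> real \<Rightarrow> real \<Rightarrow> real" where
  "capacity_I Pm Pn \<Psi> \<eta> h hmp g = ln (1 + SINR_I Pm Pn \<Psi> \<eta> h hmp g)"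

definition capacity_NI :: "real \<Rightarrow> real \<Rightarrow> real \<Rightarrow> real \<Rightarrow> real \<Rightarrow> real" where
  "capacity_NI Pm \<Psi> \<eta> h hmp = ln (1 + SNR_NI Pm \<Psi> \<eta> h hmp)"

text \<open>
  \<open>U\<close> is the set of subcarriers used by the primary user and \<open>K\<close> the set of subcarriers picked by
  the secondary user; \<open>CI i\<close> and \<open>CNI i\<close> are the capacities of the \<open>i\<close>-th subcarrier with and without
  interference. As in the model, both sums start at index 1: the numbers of collided and of
  collision-free subcarriers matter, not which subcarriers these are.
\<close>

definition SU_capacity :: "nat set \<Rightarrow> nat set \<Rightarrow> (nat \<Rightarrow> real) \<Rightarrow> (nat \<Rightarrow> real) \<Rightarrow> real" where
  "SU_capacity U K CI CNI =
    (let kn = card (K \<inter> U); kf = card K - kn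
     in (\<Sum>i=1..kn. CI i) + (\<Sum>i=1..kf. CNI i))"

end

theory Submission
  imports Defs "HOL-Real_Asymp.Real_Asymp"
begin

text \<open>
  Since the subcarrier choice is independent of the gains, Wald's identity for bounded random
  indices reduces the mean capacity to the mean number of collisions, which is found by double
  counting.

  Under Rayleigh fading, \<open>ln (1 + S)\<close> is the integral of \<open>1 / (1 + s)\<close> over \<open>0 \<le> s \<le> S\<close>, so
  by Tonelli its mean is the integral of \<open>P(S \<ge> s) / (1 + s)\<close>. The tail \<open>P(S \<ge> s)\<close> is elementary
  without interference; with interference, averaging it over \<open>g\<close> produces the factor
  \<open>\<Gamma>(0, \<dots>)\<close>. Partial fractions and
  \<open>\<integral>\<^sub>0\<^sup>\<infinity> exp (- b s) / (a + s) ds = exp (a b) \<Gamma>(0, a b)\<close> give the closed forms.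
\<close>

section \<open>Exponential integrals\<close>

text \<open>The exchanges of integration are carried out with nonnegative integrals, so that Tonelli
  asks for no convergence; real integrals come last. This also settles convergence of the Gamma
  integral without estimating its integrand. Interference only enlarges the denominator of the SINR,
  so 0 <= \<open>CI\<close> <= \<open>CNI\<close> almost surely, and the tail without interference
  is at most exp (- (y / P)). Hence both means are finite under Rayleigh fading, and so is each of
  the two nonnegative integrals into which the mean of \<open>CI\<close> splits. The same inequality
  lets the general identity assume integrability of \<open>CNI\<close> only.

  The partial fractions have the poles -1 and -\<Psi> / \<eta> without interference, -1 and -Pm / Pn
  with it. The poles merge exactly if \<Psi> = \<eta> or Pm = Pn, the values at which the closed
  forms divide by zero; the integrability claims are proved without excluding them.\<close>

lemma ln_eq_nn_integral:
  fixes x :: real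
  assumes "x \<ge> 0"
  shows "ennreal (ln (1 + x)) = (\<integral>\<^sup>+s\<in>{0..}. ennreal (1 / (1 + s)) * indicator {s..} x \<partial>lborel)"
proof -
  have "(\<integral>\<^sup>+s. ennreal (1 / (1 + s)) * indicator {0..x} s \<partial>lborel) = ennreal (ln (1 + x) - ln (1 + 0))"
    by (rule nn_integral_FTC_Icc) (use assms in \<open>auto intro!: derivative_eq_intros\<close>)
  also have "(\<integral>\<^sup>+s. ennreal (1 / (1 + s)) * indicator {0..x} s \<partial>lborel) =
      (\<integral>\<^sup>+s\<in>{0..}. ennreal (1 / (1 + s)) * indicator {s..} x \<partial>lborel)"
    by (intro nn_integral_cong) (auto simp: indicator_def)
  finally show ?thesis by simp
qed

lemma nn_integral_exp_atLeast:
  fixes a b :: real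
  assumes "b > 0"
  shows "(\<integral>\<^sup>+t\<in>{a..}. ennreal (exp (- (b * t))) \<partial>lborel) = ennreal (exp (- (b * a)) / b)"
proof -
  have lim: "((\<lambda>t. - exp (- (b * t)) / b) \<longlongrightarrow> 0) at_top"
    using assms by real_asymp
  have "(\<integral>\<^sup>+t\<in>{a..}. ennreal (exp (- (b * t))) \<partial>lborel) = ennreal (0 - (- exp (- (b * a)) / b))"
    by (rule nn_integral_FTC_atLeast[OF _ _ _ lim])
      (use assms in \<open>auto intro!: derivative_eq_intros\<close>)
  then show ?thesis by simp
qed

text \<open>Integrating over \<open>x\<close> first leaves the probability exp (- (s / c)) that a
  mean-1 exponential variable is at least s / c.\<close>

lemma nn_integral_ln_exp:
  fixes c :: real
  assumes c: "c > 0"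
  shows "(\<integral>\<^sup>+x\<in>{0..}. ennreal (ln (1 + x * c)) * ennreal (exp (- x)) \<partial>lborel) =
    (\<integral>\<^sup>+s\<in>{0..}. ennreal (exp (- (s / c)) / (1 + s)) \<partial>lborel)"
proof -
  \<comment> \<open>Written with \<open>if\<close>, the condition that links \<open>s\<close> and
    \<open>x\<close> is visibly a measurable predicate of the pair, as the exchange of integrals
    requires.\<close>
  have "(\<integral>\<^sup>+x\<in>{0..}. ennreal (ln (1 + x * c)) * ennreal (exp (- x)) \<partial>lborel) =
     (\<integral>\<^sup>+x. \<integral>\<^sup>+s. (if s \<le> x * c then 1 else 0) * indicator {0..} s * indicator {0..} x * ennreal (1 / (1 + s)) *
         ennreal (exp (- x)) \<partial>lborel \<partial>lborel)"
  proof (rule nn_integral_cong)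
    fix x :: real
    show "ennreal (ln (1 + x * c)) * ennreal (exp (- x)) * indicator {0..} x =
      (\<integral>\<^sup>+s. (if s \<le> x * c then 1 else 0) * indicator {0..} s * indicator {0..} x * ennreal (1 / (1 + s)) *
         ennreal (exp (- x)) \<partial>lborel)"
    proof (cases "x \<ge> 0")
      case True
      then have "ennreal (ln (1 + x * c)) * ennreal (exp (- x)) =
         (\<integral>\<^sup>+s. ennreal (1 / (1 + s)) * indicator {s..} (x * c) * indicator {0..} s * ennreal (exp (- x)) \<partial>lborel)"
        using c by (subst ln_eq_nn_integral) (auto simp: nn_integral_multc indicator_def)
      with True show ?thesis
        by (auto simp: indicator_def mult.commute intro!: nn_integral_cong)
    qed auto
  qed
  also have "\<dots> = (\<integral>\<^sup>+s. \<integral>\<^sup>+x. (if s \<le> x * c then 1 else 0) * indicator {0..} s * indicator {0..} x * ennreal (1 / (1 + s)) *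
         ennreal (exp (- x)) \<partial>lborel \<partial>lborel)"
    by (rule lborel_pair.Fubini') measurable
  also have "\<dots> = (\<integral>\<^sup>+s\<in>{0..}. ennreal (exp (- (s / c)) / (1 + s)) \<partial>lborel)"
  proof (rule nn_integral_cong)
    fix s :: real
    show "(\<integral>\<^sup>+x. (if s \<le> x * c then 1 else 0) * indicator {0..} s * indicator {0..} x * ennreal (1 / (1 + s)) *
         ennreal (exp (- x)) \<partial>lborel) = ennreal (exp (- (s / c)) / (1 + s)) * indicator {0..} s"
    proof (cases "s \<ge> 0")
      case True
      have "(\<integral>\<^sup>+x. (if s \<le> x * c then 1 else 0) * indicator {0..} s * indicator {0..} x * ennreal (1 / (1 + s)) *
         ennreal (exp (- x)) \<partial>lborel) = (\<integral>\<^sup>+x. ennreal (1 / (1 + s)) * (ennreal (exp (- (1 * x))) * indicator {s / c..} x) \<partial>lborel)"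
        using True c by (intro nn_integral_cong)
          (auto simp: indicator_def field_simps intro: order_trans[of 0 "s / c"])
      also have "\<dots> = ennreal (1 / (1 + s)) * ennreal (exp (- (s / c)))"
        using nn_integral_exp_atLeast[of 1 "s / c"] by (subst nn_integral_cmult) auto
      finally show ?thesis
        using True by (simp add: ennreal_mult'[symmetric])
    qed auto
  qed
  finally show ?thesis .
qed

text \<open>Given the gain \<open>t\<close> to the primary base station, the tail of the received
  power at \<open>y\<close> is exp (- (y * max (1 / P) (t / \<Psi>))); this averages it over
  \<open>t\<close>. The maximum changes branch at t = \<Psi> / P, where the interference limit
  starts to bind.\<close>

lemma nn_integral_exp_max:
  fixes P \<Psi> y :: real
  assumes "P > 0" "\<Psi> > 0" "y \<ge> 0"
  shows "(\<integral>\<^sup>+t\<in>{0..}. ennreal (exp (- (y * max (1 / P) (t / \<Psi>)))) * ennreal (exp (- t)) \<partial>lborel) =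
    ennreal ((1 - exp (- \<Psi> / P)) * exp (- (y / P)) + exp (- ((\<Psi> + y) / P)) * (\<Psi> / (\<Psi> + y)))"
proof -
  have "(\<integral>\<^sup>+t\<in>{0..}. ennreal (exp (- (y * max (1 / P) (t / \<Psi>)))) * ennreal (exp (- t)) \<partial>lborel) =
    (\<integral>\<^sup>+t. ennreal (exp (- (y / P)) * exp (- t)) * indicator {0..\<Psi> / P} t +
       ennreal (exp (- ((y / \<Psi> + 1) * t))) * indicator {\<Psi> / P..} t \<partial>lborel)"
  \<comment> \<open>Both closed intervals contain \<Psi> / P, so the sum counts this point twice; it
    is a null set.\<close>
  proof (rule nn_integral_cong_AE, rule AE_mp[OF AE_lborel_singleton[of "\<Psi> / P"]], intro AE_I2 impI)
    fix t :: real
    assume t: "t \<noteq> \<Psi> / P"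
    show "ennreal (exp (- (y * max (1 / P) (t / \<Psi>)))) * ennreal (exp (- t)) * indicator {0..} t =
       ennreal (exp (- (y / P)) * exp (- t)) * indicator {0..\<Psi> / P} t +
       ennreal (exp (- ((y / \<Psi> + 1) * t))) * indicator {\<Psi> / P..} t"
    proof (cases "t < \<Psi> / P")
      case True
      then have "max (1 / P) (t / \<Psi>) = 1 / P"
        using assms by (simp add: field_simps max_def)
      with True show ?thesis by (simp add: indicator_def ennreal_mult')
    next
      case False
      then have t: "t > \<Psi> / P" using t by simp
      then have "max (1 / P) (t / \<Psi>) = t / \<Psi>"
        using assms by (simp add: field_simps max_def)
      moreover have "0 \<le> t" using t assms by (meson divide_pos_pos less_imp_le order.strict_trans)
      ultimately show ?thesis using t
        by (simp add: indicator_def ennreal_mult'[symmetric] exp_add[symmetric] algebra_simps)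
    qed
  qed
  also have "\<dots> = (\<integral>\<^sup>+t. ennreal (exp (- (y / P)) * exp (- t)) * indicator {0..\<Psi> / P} t \<partial>lborel) +
       (\<integral>\<^sup>+t. ennreal (exp (- ((y / \<Psi> + 1) * t))) * indicator {\<Psi> / P..} t \<partial>lborel)"
    by (rule nn_integral_add) auto
  also have "(\<integral>\<^sup>+t. ennreal (exp (- ((y / \<Psi> + 1) * t))) * indicator {\<Psi> / P..} t \<partial>lborel) =
      ennreal (exp (- ((y / \<Psi> + 1) * (\<Psi> / P))) / (y / \<Psi> + 1))"
    using assms by (intro nn_integral_exp_atLeast) (simp add: add_nonneg_pos)
  also have "exp (- ((y / \<Psi> + 1) * (\<Psi> / P))) / (y / \<Psi> + 1) = exp (- ((\<Psi> + y) / P)) * (\<Psi> / (\<Psi> + y))"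
    using assms by (simp add: field_simps)
  also have "(\<integral>\<^sup>+t. ennreal (exp (- (y / P)) * exp (- t)) * indicator {0..\<Psi> / P} t \<partial>lborel) =
      ennreal (- exp (- (y / P)) * exp (- (\<Psi> / P)) - (- exp (- (y / P)) * exp (- 0)))"
    by (rule nn_integral_FTC_Icc) (use assms in \<open>auto intro!: derivative_eq_intros\<close>)
  also have "- exp (- (y / P)) * exp (- (\<Psi> / P)) - (- exp (- (y / P)) * exp (- 0)) = (1 - exp (- \<Psi> / P)) * exp (- (y / P))"
    by (simp add: algebra_simps)
  finally show ?thesis
    using assms by (subst ennreal_plus) auto
qed

text \<open>The substitution t = b * (a + s) carries the ray s > 0 to t > a * b and the measure ds /
  (a + s) to dt / t; the shift of the exponent by a * b produces the factor exp (a * b).\<close>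

lemma nn_integral_exp_divide:
  fixes a b :: real
  assumes "a > 0" "b > 0"
  shows "(\<integral>\<^sup>+s\<in>{0..}. ennreal (exp (- (b * s)) / (a + s)) \<partial>lborel) =
    ennreal (exp (a * b) * upper_Gamma 0 (a * b))"
proof -
  let ?f = "\<lambda>t. indicator {a * b<..} t * (exp (- t) / t)"
  have ab: "a * b > 0" using assms by simp
  have "integrable lborel (\<lambda>t. indicator {a * b..} t * exp (- t))"
    using nn_integral_exp_atLeast[of 1 "a * b"]
    by (intro integrableI_nonneg)
       (auto simp: ennreal_mult' ennreal_indicator mult.commute)
  then have int1: "integrable lborel (\<lambda>t. (1 / (a * b)) * (indicator {a * b..} t * exp (- t)))"
    by simp
  \<comment> \<open>For t > a * b the factor 1 / t is below 1 / (a * b). Without integrability the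
    Bochner integral in \<open>upper_Gamma\<close> would be 0 by default and say nothing about the
    nonnegative integral.\<close>
  have int: "integrable lborel ?f"
    by (rule Bochner_Integration.integrable_bound[OF int1])
      (use ab in \<open>auto simp: indicator_def intro!: divide_left_mono mult_pos_pos[OF _ ab]\<close>)
  have G: "upper_Gamma 0 (a * b) = integral\<^sup>L lborel ?f"
    unfolding upper_Gamma_def set_lebesgue_integral_def
    by (rule Bochner_Integration.integral_cong) (use ab in \<open>auto simp: indicator_def powr_minus field_simps\<close>)
  have "ennreal (upper_Gamma 0 (a * b)) = (\<integral>\<^sup>+t. ennreal (?f t) \<partial>lborel)"
    unfolding G by (rule nn_integral_eq_integral[OF int, symmetric]) (use ab in \<open>auto simp: indicator_def\<close>)
  also have "\<dots> = ennreal \<bar>b\<bar> * (\<integral>\<^sup>+s. ennreal (?f (a * b + b * s)) \<partial>lborel)"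
    by (rule nn_integral_real_affine) (use assms in auto)
  also have "\<dots> = (\<integral>\<^sup>+s. ennreal \<bar>b\<bar> * ennreal (?f (a * b + b * s)) \<partial>lborel)"
    by (subst nn_integral_cmult) auto
  also have "\<dots> = (\<integral>\<^sup>+s. ennreal (exp (- (a * b))) * (ennreal (exp (- (b * s)) / (a + s)) * indicator {0..} s) \<partial>lborel)"
  \<comment> \<open>The open ray of \<open>upper_Gamma\<close> and the closed ray
    \<open>{0..}\<close> disagree only at s = 0.\<close>
  proof (rule nn_integral_cong_AE, rule AE_mp[OF AE_lborel_singleton[of 0]], intro AE_I2 impI)
    fix s :: real assume "s \<noteq> 0"
    have "exp (- (a * b) - b * s) / (a * b + b * s) * b = exp (- (a * b)) * (exp (- (b * s)) / (a + s))" if "s > 0"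
    proof -
      have "exp (- (a * b) - b * s) = exp (- (a * b)) * exp (- (b * s))"
        by (simp add: exp_add[symmetric])
      moreover have "a * b + b * s = b * (a + s)"
        by (simp add: algebra_simps)
      ultimately show ?thesis using that assms by simp
    qed
    then show "ennreal \<bar>b\<bar> * ennreal (?f (a * b + b * s)) =
       ennreal (exp (- (a * b))) * (ennreal (exp (- (b * s)) / (a + s)) * indicator {0..} s)"
      using \<open>s \<noteq> 0\<close> assms by (auto simp: indicator_def ennreal_mult'[symmetric] zero_less_mult_iff mult.commute)
  qed
  also have "\<dots> = ennreal (exp (- (a * b))) * (\<integral>\<^sup>+s\<in>{0..}. ennreal (exp (- (b * s)) / (a + s)) \<partial>lborel)"
    by (rule nn_integral_cmult) auto
  finally have "ennreal (exp (a * b)) * ennreal (upper_Gamma 0 (a * b)) =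
    ennreal (exp (a * b)) * (ennreal (exp (- (a * b))) * (\<integral>\<^sup>+s\<in>{0..}. ennreal (exp (- (b * s)) / (a + s)) \<partial>lborel))"
    by simp
  also have "\<dots> = (\<integral>\<^sup>+s\<in>{0..}. ennreal (exp (- (b * s)) / (a + s)) \<partial>lborel)"
    by (simp add: mult.assoc[symmetric] ennreal_mult'[symmetric] exp_add[symmetric])
  finally show ?thesis by (simp add: ennreal_mult')
qed

section \<open>Mean capacity under Rayleigh fading\<close>

text \<open>
  \<open>rx_tail P \<Psi> y\<close> is the probability that \<open>h * min P (\<Psi> / hmp)\<close> exceeds \<open>y\<close> when \<open>h\<close> and \<open>hmp\<close>
  are independent and exponential with mean 1; the two terms come from \<open>hmp < \<Psi> / P\<close> and
  \<open>hmp > \<Psi> / P\<close>.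
\<close>

definition rx_tail :: "real \<Rightarrow> real \<Rightarrow> real \<Rightarrow> real" where
  "rx_tail P \<Psi> y = (1 - exp (- \<Psi> / P)) * exp (- (y / P)) + exp (- ((\<Psi> + y) / P)) * (\<Psi> / (\<Psi> + y))"

lemma rx_tail_measurable [measurable]: "rx_tail P \<Psi> \<in> borel_measurable borel"
  unfolding rx_tail_def by measurable

text \<open>Splits off exp (- (y / P)), the tail at full power \<open>P\<close>; the other factor is
  the loss due to the interference limit. The bound \<open>rx_tail_le\<close> and the partial
  fractions without interference both start from this form.\<close>

lemma rx_tail_eq:
  assumes "\<Psi> > 0" "y \<ge> 0"
  shows "rx_tail P \<Psi> y = exp (- (y / P)) * (1 - exp (- \<Psi> / P) * (y / (\<Psi> + y)))"
proof -
  have 1: "\<Psi> / (\<Psi> + y) = 1 - y / (\<Psi> + y)" using assms by (simp add: field_simps)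
  have 2: "exp (- ((\<Psi> + y) / P)) = exp (- (y / P)) * exp (- \<Psi> / P)"
    by (simp add: exp_add[symmetric] add_divide_distrib)
  show ?thesis
    unfolding rx_tail_def 1 2 by (simp add: algebra_simps)
qed

lemma rx_tail_nonneg:
  assumes "P > 0" "\<Psi> > 0" "y \<ge> 0"
  shows "rx_tail P \<Psi> y \<ge> 0"
  unfolding rx_tail_def using assms by (intro add_nonneg_nonneg mult_nonneg_nonneg) auto

lemma rx_tail_le:
  assumes "\<Psi> > 0" "y \<ge> 0"
  shows "rx_tail P \<Psi> y \<le> exp (- (y / P))"
proof -
  have "0 \<le> exp (- \<Psi> / P) * (y / (\<Psi> + y))" using assms by simp
  then show ?thesis
    by (simp add: rx_tail_eq[OF assms] mult_le_cancel_left1)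
qed

lemma nn_integral_exponential_density:
  assumes [measurable]: "f \<in> borel_measurable borel"
  shows "(\<integral>\<^sup>+x. f x \<partial>density lborel (exponential_density 1)) =
    (\<integral>\<^sup>+x\<in>{0..}. f x * ennreal (exp (- x)) \<partial>lborel)"
  by (subst nn_integral_density)
    (auto simp: exponential_density_def indicator_def mult.commute intro!: nn_integral_cong)

lemma received_power_measurable [measurable (raw)]:
  assumes [measurable]: "f \<in> borel_measurable N" "k \<in> borel_measurable N"
  shows "(\<lambda>w. received_power Pm \<Psi> (f w) (k w)) \<in> borel_measurable N"
  unfolding received_power_def by measurable

lemma capacity_I_measurable [measurable (raw)]:
  assumes [measurable]: "f \<in> borel_measurable N" "k \<in> borel_measurable N" "l \<in> borel_measurable N"
  shows "(\<lambda>w. capacity_I Pm Pn \<Psi> \<eta> (f w) (k w) (l w)) \<in> borel_measurable N"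
  unfolding capacity_I_def SINR_I_def by measurable

lemma capacity_NI_measurable [measurable (raw)]:
  assumes [measurable]: "f \<in> borel_measurable N" "k \<in> borel_measurable N"
  shows "(\<lambda>w. capacity_NI Pm \<Psi> \<eta> (f w) (k w)) \<in> borel_measurable N"
  unfolding capacity_NI_def SNR_NI_def by measurable

lemma capacity_bounds:
  fixes Pm Pn \<Psi> \<eta> x t z :: real
  assumes pos: "Pm > 0" "Pn > 0" "\<Psi> > 0" "\<eta> > 0" and "x > 0" "t > 0" "z > 0"
  shows "0 \<le> capacity_I Pm Pn \<Psi> \<eta> x t z" "capacity_I Pm Pn \<Psi> \<eta> x t z \<le> capacity_NI Pm \<Psi> \<eta> x t"
proof -
  have r: "received_power Pm \<Psi> x t > 0"
    using assms by (simp add: received_power_def)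
  have d: "0 < \<eta>" "\<eta> \<le> Pn * z + \<eta>" using assms by simp_all
  have "0 \<le> SINR_I Pm Pn \<Psi> \<eta> x t z" "SINR_I Pm Pn \<Psi> \<eta> x t z \<le> SNR_NI Pm \<Psi> \<eta> x t"
    unfolding SINR_I_def SNR_NI_def using r d assms by (auto intro!: divide_left_mono mult_pos_pos add_pos_pos)
  then show "0 \<le> capacity_I Pm Pn \<Psi> \<eta> x t z" "capacity_I Pm Pn \<Psi> \<eta> x t z \<le> capacity_NI Pm \<Psi> \<eta> x t"
    unfolding capacity_I_def capacity_NI_def by simp_all
qed

text \<open>The denominator \<open>d\<close> is left general to serve both capacities: it is \<eta>
  without interference and Pn * z + \<eta> once the interfering gain is fixed at
  \<open>z\<close>.\<close>

lemma nn_integral_ln_received_power: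
  fixes Pm \<Psi> d :: real
  assumes "Pm > 0" "\<Psi> > 0" "d > 0"
  defines "E \<equiv> density lborel (exponential_density 1)"
  shows "(\<integral>\<^sup>+t. \<integral>\<^sup>+x. ennreal (ln (1 + received_power Pm \<Psi> x t / d)) \<partial>E \<partial>E) =
    (\<integral>\<^sup>+s\<in>{0..}. ennreal (rx_tail Pm \<Psi> (s * d) / (1 + s)) \<partial>lborel)"
proof -
  interpret E: prob_space E
    unfolding E_def by (rule prob_space_exponential_density) simp
  have [measurable_cong]: "sets E = sets borel" by (simp add: E_def)
  have "(\<integral>\<^sup>+t. \<integral>\<^sup>+x. ennreal (ln (1 + received_power Pm \<Psi> x t / d)) \<partial>E \<partial>E) =
     (\<integral>\<^sup>+t. (\<integral>\<^sup>+x. ennreal (ln (1 + received_power Pm \<Psi> x t / d)) \<partial>E) * ennreal (exp (- t)) * indicator {0..} t \<partial>lborel)"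
    by (subst E_def, subst nn_integral_exponential_density) auto
  also have "\<dots> = (\<integral>\<^sup>+t. \<integral>\<^sup>+s. ennreal (exp (- (s * d * max (1 / Pm) (t / \<Psi>))) / (1 + s)) *
      indicator {0..} s * ennreal (exp (- t)) * indicator {0..} t \<partial>lborel \<partial>lborel)"
  \<comment> \<open>At t = 0 the convention \<Psi> / 0 = 0 makes the received power vanish, so the
    two integrands differ there.\<close>
  proof (rule nn_integral_cong_AE, rule AE_mp[OF AE_lborel_singleton[of 0]], intro AE_I2 impI)
    fix t :: real assume "t \<noteq> 0"
    show "(\<integral>\<^sup>+x. ennreal (ln (1 + received_power Pm \<Psi> x t / d)) \<partial>E) * ennreal (exp (- t)) * indicator {0..} t =
      (\<integral>\<^sup>+s. ennreal (exp (- (s * d * max (1 / Pm) (t / \<Psi>))) / (1 + s)) *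
      indicator {0..} s * ennreal (exp (- t)) * indicator {0..} t \<partial>lborel)"
    proof (cases "t > 0")
      case True
      \<comment> \<open>For fixed \<open>t\<close> the ratio is x * c, and dividing \<open>s\<close>
        by \<open>c\<close> turns the minimum of powers into the maximum of their
        reciprocals.\<close>
      define c where "c = min Pm (\<Psi> / t) / d"
      have c: "c > 0" using True assms by (simp add: c_def)
      have "s / c = s * d * max (1 / Pm) (t / \<Psi>)" for s
        using True assms by (auto simp: c_def min_def max_def field_simps)
      moreover have "(\<integral>\<^sup>+x. ennreal (ln (1 + received_power Pm \<Psi> x t / d)) \<partial>E) =
         (\<integral>\<^sup>+x\<in>{0..}. ennreal (ln (1 + x * c)) * ennreal (exp (- x)) \<partial>lborel)"
        unfolding E_def by (subst nn_integral_exponential_density) (auto simp: c_def received_power_def)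
      ultimately show ?thesis
        using nn_integral_ln_exp[OF c] by (simp add: nn_integral_multc)
    qed (use \<open>t \<noteq> 0\<close> in auto)
  qed
  also have "\<dots> = (\<integral>\<^sup>+s. \<integral>\<^sup>+t. ennreal (exp (- (s * d * max (1 / Pm) (t / \<Psi>))) / (1 + s)) *
      indicator {0..} s * ennreal (exp (- t)) * indicator {0..} t \<partial>lborel \<partial>lborel)"
    by (rule lborel_pair.Fubini') measurable
  also have "\<dots> = (\<integral>\<^sup>+s\<in>{0..}. ennreal (rx_tail Pm \<Psi> (s * d) / (1 + s)) \<partial>lborel)"
  proof (rule nn_integral_cong)
    fix s :: real
    show "(\<integral>\<^sup>+t. ennreal (exp (- (s * d * max (1 / Pm) (t / \<Psi>))) / (1 + s)) *
      indicator {0..} s * ennreal (exp (- t)) * indicator {0..} t \<partial>lborel) =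
      ennreal (rx_tail Pm \<Psi> (s * d) / (1 + s)) * indicator {0..} s"
    proof (cases "s \<ge> 0")
      case True
      have "(\<integral>\<^sup>+t. ennreal (exp (- (s * d * max (1 / Pm) (t / \<Psi>))) / (1 + s)) *
          indicator {0..} s * ennreal (exp (- t)) * indicator {0..} t \<partial>lborel) =
        (\<integral>\<^sup>+t. ennreal (1 / (1 + s)) * (ennreal (exp (- (s * d * max (1 / Pm) (t / \<Psi>)))) *
          ennreal (exp (- t)) * indicator {0..} t) \<partial>lborel)"
        using True by (intro nn_integral_cong) (auto simp: indicator_def ennreal_mult'[symmetric])
      also have "\<dots> = ennreal (1 / (1 + s)) * ennreal (rx_tail Pm \<Psi> (s * d))"
        using True assms nn_integral_exp_max[of Pm \<Psi> "s * d"]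
        by (subst nn_integral_cmult) (auto simp: rx_tail_def)
      finally show ?thesis
        using True by (simp add: ennreal_mult'[symmetric])
    qed auto
  qed
  finally show ?thesis .
qed

lemma upper_Gamma_nonneg: "upper_Gamma x y \<ge> 0"
  unfolding upper_Gamma_def set_lebesgue_integral_def
  by (rule Bochner_Integration.integral_nonneg) (auto simp: indicator_def)

text \<open>The mean with interference has \<open>upper_Gamma\<close> under an integral sign. Moving
  the variable limit into the integrand makes it a parameter integral over a fixed measure.\<close>

lemma upper_Gamma_measurable [measurable]:
  "upper_Gamma x \<in> borel_measurable borel"
proof -
  have "upper_Gamma x = (\<lambda>y. LINT t|lborel. (if y < t then t powr (x - 1) * exp (- t) else 0))"
    unfolding upper_Gamma_def set_lebesgue_integral_def
    by (intro ext Bochner_Integration.integral_cong) (auto simp: indicator_def)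
  moreover have "(\<lambda>y. LINT t|lborel. (if y < t then t powr (x - 1) * exp (- t) else 0)) \<in> borel_measurable borel"
    by (rule lborel.borel_measurable_lebesgue_integral) measurable
  ultimately show ?thesis by simp
qed

text \<open>Partial fractions need differences of such integrals, hence the passage from nonnegative
  to real integrals.\<close>

lemma has_bochner_integral_exp_divide:
  fixes a b :: real
  assumes "a > 0" "b > 0"
  shows "has_bochner_integral lborel (\<lambda>s. indicator {0..} s * (exp (- (b * s)) / (a + s)))
    (exp (a * b) * upper_Gamma 0 (a * b))"
proof (rule has_bochner_integral_nn_integral)
  have "(\<integral>\<^sup>+s. ennreal (indicator {0..} s * (exp (- (b * s)) / (a + s))) \<partial>lborel) =
    (\<integral>\<^sup>+s\<in>{0..}. ennreal (exp (- (b * s)) / (a + s)) \<partial>lborel)"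
    by (intro nn_integral_cong) (auto simp: indicator_def)
  then show "(\<integral>\<^sup>+s. ennreal (indicator {0..} s * (exp (- (b * s)) / (a + s))) \<partial>lborel) =
    ennreal (exp (a * b) * upper_Gamma 0 (a * b))"
    using nn_integral_exp_divide[OF assms] by simp
qed (use assms upper_Gamma_nonneg in \<open>auto simp: indicator_def\<close>)

text \<open>By \<open>rx_tail_eq\<close> the rational factor is (1 - e * (s * \<eta> / (\<Psi> + s *
  \<eta>))) / (1 + s) with e = exp (- \<Psi> / Pm). Its residues are 1 + e * \<eta> / (\<Psi> -
  \<eta>) at -1 and - e * \<Psi> / (\<Psi> - \<eta>) at -\<Psi> / \<eta>.\<close>

lemma has_bochner_integral_rx_tail:
  fixes Pm \<Psi> \<eta> :: real
  assumes "Pm > 0" "\<Psi> > 0" "\<eta> > 0" "\<Psi> \<noteq> \<eta>"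
  shows "has_bochner_integral lborel (\<lambda>s. indicator {0..} s * (rx_tail Pm \<Psi> (s * \<eta>) / (1 + s)))
    (upper_Gamma 0 (\<eta> / Pm) * exp (\<eta> / Pm) * (1 + exp (- \<Psi> / Pm) * \<eta> / (\<Psi> - \<eta>))
            + \<Psi> / (\<eta> - \<Psi>) * upper_Gamma 0 (\<Psi> / Pm))"
proof -
  let ?e = "exp (- \<Psi> / Pm)" and ?q = "\<lambda>a s. indicator {0..} s * (exp (- (\<eta> / Pm * s)) / (a + s))"
  have b: "\<eta> / Pm > 0" "\<Psi> / \<eta> > 0" using assms by auto
  note I1 = has_bochner_integral_exp_divide[OF zero_less_one b(1)]
  note I2 = has_bochner_integral_exp_divide[OF b(2,1)]
  have I: "has_bochner_integral lborel
     (\<lambda>s. (1 + ?e * \<eta> / (\<Psi> - \<eta>)) * ?q 1 s - (?e * \<Psi> / (\<Psi> - \<eta>)) * ?q (\<Psi> / \<eta>) s)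
     ((1 + ?e * \<eta> / (\<Psi> - \<eta>)) * (exp (1 * (\<eta> / Pm)) * upper_Gamma 0 (1 * (\<eta> / Pm)))
       - (?e * \<Psi> / (\<Psi> - \<eta>)) * (exp (\<Psi> / \<eta> * (\<eta> / Pm)) * upper_Gamma 0 (\<Psi> / \<eta> * (\<eta> / Pm))))"
    by (intro has_bochner_integral_diff has_bochner_integral_mult_right I1 I2)
  have eq1: "(1 + ?e * \<eta> / (\<Psi> - \<eta>)) * ?q 1 s - (?e * \<Psi> / (\<Psi> - \<eta>)) * ?q (\<Psi> / \<eta>) s =
     indicator {0..} s * (rx_tail Pm \<Psi> (s * \<eta>) / (1 + s))" for s
  proof (cases "s \<ge> 0")
    case True
    have nz: "\<Psi> + s * \<eta> \<noteq> 0" "1 + s \<noteq> 0" "\<Psi> / \<eta> + s \<noteq> 0" "\<Psi> - \<eta> \<noteq> 0"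
      using True assms by (smt (verit) mult_nonneg_nonneg divide_pos_pos)+
    have "(1 + ?e * \<eta> / (\<Psi> - \<eta>)) * (1 / (1 + s)) - (?e * \<Psi> / (\<Psi> - \<eta>)) * (1 / (\<Psi> / \<eta> + s))
      = (1 - ?e * (s * \<eta> / (\<Psi> + s * \<eta>))) / (1 + s)"
    proof -
      have r: "1 / (\<Psi> / \<eta> + s) = \<eta> / (\<Psi> + s * \<eta>)"
        using nz assms by (simp add: field_simps)
      \<comment> \<open>Both sides are affine in \<open>e\<close> with the same constant term
        \<open>u\<close>, so comparing the coefficients of \<open>e\<close> suffices; this keeps the
        exponential out of the fraction arithmetic.\<close>
      have alg: "(1 + e * x) * u - e * y * v = (1 - e * w) * u" if "x * u - y * v = - w * u" for e x y u v w :: real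
        using that by algebra
      have "\<eta> / (\<Psi> - \<eta>) * (1 / (1 + s)) - \<Psi> / (\<Psi> - \<eta>) * (\<eta> / (\<Psi> + s * \<eta>)) = - (s * \<eta> / (\<Psi> + s * \<eta>)) * (1 / (1 + s))"
        using nz by (simp add: divide_simps) (simp add: algebra_simps)
      from alg[OF this, of ?e] show ?thesis unfolding r by simp
    qed
    then have "exp (- (s * \<eta> / Pm)) * ((1 + ?e * \<eta> / (\<Psi> - \<eta>)) * (1 / (1 + s)) - (?e * \<Psi> / (\<Psi> - \<eta>)) * (1 / (\<Psi> / \<eta> + s))) =
       exp (- (s * \<eta> / Pm)) * ((1 - ?e * (s * \<eta> / (\<Psi> + s * \<eta>))) / (1 + s))" by simp
    also have "exp (- (s * \<eta> / Pm)) * ((1 - ?e * (s * \<eta> / (\<Psi> + s * \<eta>))) / (1 + s)) =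
      rx_tail Pm \<Psi> (s * \<eta>) / (1 + s)"
      using True assms by (simp add: rx_tail_eq)
    finally show ?thesis
      using True by (simp add: right_diff_distrib mult_ac)
  qed auto
  \<comment> \<open>The pole -\<Psi> / \<eta> contributes exp (\<Psi> / Pm), which cancels
    \<open>?e\<close>; so the last Gamma term carries no exponential.\<close>
  have e: "?e * exp (\<Psi> / Pm) = 1" by (simp add: exp_add[symmetric])
  have eq2: "(1 + ?e * \<eta> / (\<Psi> - \<eta>)) * (exp (1 * (\<eta> / Pm)) * upper_Gamma 0 (1 * (\<eta> / Pm)))
       - (?e * \<Psi> / (\<Psi> - \<eta>)) * (exp (\<Psi> / \<eta> * (\<eta> / Pm)) * upper_Gamma 0 (\<Psi> / \<eta> * (\<eta> / Pm))) =
     upper_Gamma 0 (\<eta> / Pm) * exp (\<eta> / Pm) * (1 + exp (- \<Psi> / Pm) * \<eta> / (\<Psi> - \<eta>))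
            + \<Psi> / (\<eta> - \<Psi>) * upper_Gamma 0 (\<Psi> / Pm)"
  proof -
    have "(?e * \<Psi> / (\<Psi> - \<eta>)) * (exp (\<Psi> / Pm) * upper_Gamma 0 (\<Psi> / Pm)) =
      (?e * exp (\<Psi> / Pm)) * (\<Psi> / (\<Psi> - \<eta>) * upper_Gamma 0 (\<Psi> / Pm))" by simp
    also have "\<dots> = - (\<Psi> / (\<eta> - \<Psi>) * upper_Gamma 0 (\<Psi> / Pm))"
      unfolding e using assms by (simp add: divide_simps) (simp add: algebra_simps)
    finally show ?thesis using assms by (simp add: mult_ac)
  qed
  show ?thesis
    using I unfolding eq1 eq2 .
qed

text \<open>Obtained from the bound on the tail rather than from the closed form, so that \<Psi> =
  \<eta> is covered.\<close>

lemma nn_integral_rx_tail_finite: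
  fixes Pm \<Psi> \<eta> :: real
  assumes "Pm > 0" "\<Psi> > 0" "\<eta> > 0"
  shows "(\<integral>\<^sup>+s\<in>{0..}. ennreal (rx_tail Pm \<Psi> (s * \<eta>) / (1 + s)) \<partial>lborel) < \<infinity>"
proof -
  have "(\<integral>\<^sup>+s\<in>{0..}. ennreal (rx_tail Pm \<Psi> (s * \<eta>) / (1 + s)) \<partial>lborel) \<le>
    (\<integral>\<^sup>+s\<in>{0..}. ennreal (exp (- (\<eta> / Pm * s)) / (1 + s)) \<partial>lborel)"
    using assms by (intro nn_integral_mono) (auto simp: indicator_def mult.commute intro!: ennreal_leI divide_right_mono order.trans[OF rx_tail_le])
  also have "\<dots> < \<infinity>"
    using nn_integral_exp_divide[of 1 "\<eta> / Pm"] assms by simp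
  finally show ?thesis .
qed

text \<open>As a function of the interfering gain \<open>z\<close>, each summand of
  \<open>rx_tail\<close> times the density is a multiple of exp (- (b * z)). The second one also has
  a denominator linear in \<open>z\<close>, and this is what gives the incomplete Gamma
  function.\<close>

lemma nn_integral_rx_tail_interference:
  fixes Pm Pn \<Psi> \<eta> s :: real
  assumes "Pm > 0" "Pn > 0" "\<Psi> > 0" "\<eta> > 0" "s > 0"
  shows "(\<integral>\<^sup>+z\<in>{0..}. ennreal (rx_tail Pm \<Psi> (s * (Pn * z + \<eta>))) * ennreal (exp (- z)) \<partial>lborel) =
    ennreal ((1 - exp (- \<Psi> / Pm)) * (exp (- (\<eta> / Pm * s)) / (1 + s * Pn / Pm)) +
      \<Psi> / Pn * exp (\<eta> / Pn) * (upper_Gamma 0 ((\<eta> + \<Psi> / s) * (1 / Pn + s / Pm)) *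
               (exp (\<Psi> / (s * Pn)) / s)))"
proof -
  \<comment> \<open>The number \<open>a\<close> solves \<Psi> + s * (Pn * z + \<eta>) = s * Pn * (a
    + z), and \<open>b\<close> adds the rate 1 of the density to the rate s * Pn / Pm of the
    tail.\<close>
  define a where "a = (\<Psi> + s * \<eta>) / (s * Pn)"
  define b where "b = 1 + s * Pn / Pm"
  have a: "a > 0" and b: "b > 0" using assms by (auto simp: a_def b_def intro!: add_pos_pos divide_pos_pos)
  have e0: "0 \<le> 1 - exp (- \<Psi> / Pm)" using assms by simp
  have "(\<integral>\<^sup>+z\<in>{0..}. ennreal (rx_tail Pm \<Psi> (s * (Pn * z + \<eta>))) * ennreal (exp (- z)) \<partial>lborel) =
    (\<integral>\<^sup>+z. ennreal ((1 - exp (- \<Psi> / Pm)) * exp (- (\<eta> / Pm * s))) * (ennreal (exp (- (b * z))) * indicator {0..} z) +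
       ennreal (exp (- ((\<Psi> + s * \<eta>) / Pm)) * (\<Psi> / (s * Pn))) * (ennreal (exp (- (b * z)) / (a + z)) * indicator {0..} z) \<partial>lborel)"
  proof (rule nn_integral_cong)
    fix z :: real
    have "rx_tail Pm \<Psi> (s * (Pn * z + \<eta>)) * exp (- z) =
       ((1 - exp (- \<Psi> / Pm)) * exp (- (\<eta> / Pm * s))) * exp (- (b * z)) +
       (exp (- ((\<Psi> + s * \<eta>) / Pm)) * (\<Psi> / (s * Pn))) * (exp (- (b * z)) / (a + z))" if "z \<ge> 0"
    proof -
      have 1: "exp (- (s * (Pn * z + \<eta>) / Pm)) * exp (- z) = exp (- (\<eta> / Pm * s)) * exp (- (b * z))"
        unfolding b_def exp_add[symmetric] using assms by (simp add: field_simps)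
      have 2: "exp (- ((\<Psi> + s * (Pn * z + \<eta>)) / Pm)) * exp (- z) = exp (- ((\<Psi> + s * \<eta>) / Pm)) * exp (- (b * z))"
        unfolding b_def exp_add[symmetric] using assms by (simp add: field_simps)
      have "a + z = (\<Psi> + s * (Pn * z + \<eta>)) / (s * Pn)"
        unfolding a_def using assms by (simp add: field_simps)
      then have 3: "\<Psi> / (\<Psi> + s * (Pn * z + \<eta>)) = \<Psi> / (s * Pn) / (a + z)"
        using assms by simp
      have "rx_tail Pm \<Psi> (s * (Pn * z + \<eta>)) * exp (- z) =
        (1 - exp (- \<Psi> / Pm)) * (exp (- (s * (Pn * z + \<eta>) / Pm)) * exp (- z)) +
        (exp (- ((\<Psi> + s * (Pn * z + \<eta>)) / Pm)) * exp (- z)) * (\<Psi> / (\<Psi> + s * (Pn * z + \<eta>)))"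
        unfolding rx_tail_def by (simp add: ring_distribs)
      then show ?thesis unfolding 1 2 3 by simp
    qed
    then show "ennreal (rx_tail Pm \<Psi> (s * (Pn * z + \<eta>))) * ennreal (exp (- z)) * indicator {0..} z =
      ennreal ((1 - exp (- \<Psi> / Pm)) * exp (- (\<eta> / Pm * s))) * (ennreal (exp (- (b * z))) * indicator {0..} z) +
       ennreal (exp (- ((\<Psi> + s * \<eta>) / Pm)) * (\<Psi> / (s * Pn))) * (ennreal (exp (- (b * z)) / (a + z)) * indicator {0..} z)"
      using e0 a assms by (cases "z \<ge> 0") (simp_all add: ennreal_mult''[symmetric] ennreal_plus[symmetric] del: ennreal_plus)
  qed
  also have "\<dots> = ennreal ((1 - exp (- \<Psi> / Pm)) * exp (- (\<eta> / Pm * s))) * ennreal (1 / b) +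
     ennreal (exp (- ((\<Psi> + s * \<eta>) / Pm)) * (\<Psi> / (s * Pn))) * ennreal (exp (a * b) * upper_Gamma 0 (a * b))"
    using nn_integral_exp_atLeast[OF b, of 0] nn_integral_exp_divide[OF a b]
    by (subst nn_integral_add) (auto simp: nn_integral_cmult)
  also have "\<dots> = ennreal ((1 - exp (- \<Psi> / Pm)) * exp (- (\<eta> / Pm * s)) * (1 / b) +
     exp (- ((\<Psi> + s * \<eta>) / Pm)) * (\<Psi> / (s * Pn)) * (exp (a * b) * upper_Gamma 0 (a * b)))"
    using e0 assms b upper_Gamma_nonneg[of 0 "a * b"]
    by (simp add: ennreal_mult''[symmetric] ennreal_plus[symmetric] del: ennreal_plus)
  also have "exp (- ((\<Psi> + s * \<eta>) / Pm)) * (\<Psi> / (s * Pn)) * (exp (a * b) * upper_Gamma 0 (a * b)) =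
    \<Psi> / Pn * exp (\<eta> / Pn) * (upper_Gamma 0 ((\<eta> + \<Psi> / s) * (1 / Pn + s / Pm)) *
               (exp (\<Psi> / (s * Pn)) / s))"
  proof -
    have ab: "a * b = (\<eta> + \<Psi> / s) * (1 / Pn + s / Pm)"
      unfolding a_def b_def using assms by (simp add: field_simps)
    \<comment> \<open>Expanding the product for a * b gives \<eta> / Pn + \<Psi> / (s * Pn) +
      (\<Psi> + s * \<eta>) / Pm; the last term cancels.\<close>
    have "exp (- ((\<Psi> + s * \<eta>) / Pm)) * exp (a * b) = exp (\<eta> / Pn) * exp (\<Psi> / (s * Pn))"
      unfolding exp_add[symmetric] ab using assms by (simp add: field_simps)
    then have "exp (- ((\<Psi> + s * \<eta>) / Pm)) * exp (a * b) * (\<Psi> / (s * Pn)) * upper_Gamma 0 (a * b) =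
      exp (\<eta> / Pn) * exp (\<Psi> / (s * Pn)) * (\<Psi> / (s * Pn)) * upper_Gamma 0 (a * b)"
      by simp
    then show ?thesis unfolding ab by (simp add: field_simps)
  qed
  finally show ?thesis by (simp add: b_def)
qed

text \<open>The decay rate is \<eta> / Pm at both poles, but the pole -Pm / Pn scales the argument
  of the Gamma function to (Pm / Pn) * (\<eta> / Pm) = \<eta> / Pn.\<close>

lemma has_bochner_integral_partial_fraction:
  fixes Pm Pn \<eta> :: real
  assumes "Pm > 0" "Pn > 0" "\<eta> > 0" "Pm \<noteq> Pn"
  shows "has_bochner_integral lborel
    (\<lambda>s. indicator {0..} s * (exp (- (\<eta> / Pm * s)) / ((1 + s) * (1 + s * Pn / Pm))))
    (1 / (1 - Pn / Pm) *
      (upper_Gamma 0 (\<eta> / Pm) * exp (\<eta> / Pm) - upper_Gamma 0 (\<eta> / Pn) * exp (\<eta> / Pn)))"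
proof -
  let ?q = "\<lambda>a s. indicator {0..} s * (exp (- (\<eta> / Pm * s)) / (a + s))"
  have b: "\<eta> / Pm > 0" "Pm / Pn > 0" using assms by auto
  note I1 = has_bochner_integral_exp_divide[OF zero_less_one b(1)]
  note I2 = has_bochner_integral_exp_divide[OF b(2,1)]
  have "has_bochner_integral lborel (\<lambda>s. 1 / (1 - Pn / Pm) * (?q 1 s - ?q (Pm / Pn) s))
     (1 / (1 - Pn / Pm) * (exp (1 * (\<eta> / Pm)) * upper_Gamma 0 (1 * (\<eta> / Pm))
       - exp (Pm / Pn * (\<eta> / Pm)) * upper_Gamma 0 (Pm / Pn * (\<eta> / Pm))))"
    by (intro has_bochner_integral_diff has_bochner_integral_mult_right I1 I2)
  moreover have "1 / (1 - Pn / Pm) * (?q 1 s - ?q (Pm / Pn) s) =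
     indicator {0..} s * (exp (- (\<eta> / Pm * s)) / ((1 + s) * (1 + s * Pn / Pm)))" for s
  proof (cases "s \<ge> 0")
    case True
    have nz: "Pm + s * Pn \<noteq> 0" "1 + s \<noteq> 0" "Pm - Pn \<noteq> 0" "Pm \<noteq> 0" "Pn \<noteq> 0"
      using True assms by (smt (verit) mult_nonneg_nonneg)+
    have r: "1 / (Pm / Pn + s) = Pn / (Pm + s * Pn)" "1 / (1 - Pn / Pm) = Pm / (Pm - Pn)"
       "1 / (1 + s * Pn / Pm) = Pm / (Pm + s * Pn)"
      using nz by (simp_all add: field_simps)
    have "Pm / (Pm - Pn) * (1 / (1 + s) - Pn / (Pm + s * Pn)) = (1 / (1 + s)) * (Pm / (Pm + s * Pn))"
      using nz by (simp add: divide_simps) (simp add: algebra_simps)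
    then have "1 / (1 - Pn / Pm) * (1 / (1 + s) - 1 / (Pm / Pn + s)) = (1 / (1 + s)) * (1 / (1 + s * Pn / Pm))"
      unfolding r .
    then have "exp (- (\<eta> / Pm * s)) * (1 / (1 - Pn / Pm) * (1 / (1 + s) - 1 / (Pm / Pn + s))) =
      exp (- (\<eta> / Pm * s)) * ((1 / (1 + s)) * (1 / (1 + s * Pn / Pm)))" by simp
    then show ?thesis using True by (simp add: right_diff_distrib)
  qed auto
  moreover have "Pm / Pn * (\<eta> / Pm) = \<eta> / Pn" using assms by simp
  ultimately show ?thesis by (simp add: mult_ac)
qed

text \<open>Neither integral on the right is evaluated, so the identity includes Pm = Pn, and
  finiteness of the left side passes to both.\<close>

lemma nn_integral_capacity_I:
  fixes Pm Pn \<Psi> \<eta> :: real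
  assumes pos: "Pm > 0" "Pn > 0" "\<Psi> > 0" "\<eta> > 0"
  defines "E \<equiv> density lborel (exponential_density 1)"
  shows "(\<integral>\<^sup>+z. \<integral>\<^sup>+t. \<integral>\<^sup>+x. ennreal (capacity_I Pm Pn \<Psi> \<eta> x t z) \<partial>E \<partial>E \<partial>E) =
    (\<integral>\<^sup>+s\<in>{0..}. ennreal ((1 - exp (- \<Psi> / Pm)) *
        (exp (- (\<eta> / Pm * s)) / ((1 + s) * (1 + s * Pn / Pm)))) \<partial>lborel) +
    (\<integral>\<^sup>+s\<in>{0..}. ennreal (\<Psi> / Pn * exp (\<eta> / Pn) *
        (upper_Gamma 0 ((\<eta> + \<Psi> / s) * (1 / Pn + s / Pm)) *
               (exp (\<Psi> / (s * Pn)) / (s * (1 + s))))) \<partial>lborel)"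
proof -
  interpret E: prob_space E
    unfolding E_def by (rule prob_space_exponential_density) simp
  have [measurable_cong]: "sets E = sets borel" by (simp add: E_def)
  have "(\<integral>\<^sup>+z. \<integral>\<^sup>+t. \<integral>\<^sup>+x. ennreal (capacity_I Pm Pn \<Psi> \<eta> x t z) \<partial>E \<partial>E \<partial>E) =
    (\<integral>\<^sup>+z\<in>{0..}. (\<integral>\<^sup>+t. \<integral>\<^sup>+x. ennreal (capacity_I Pm Pn \<Psi> \<eta> x t z) \<partial>E \<partial>E) * ennreal (exp (- z)) \<partial>lborel)"
    by (subst E_def, rule nn_integral_exponential_density) measurable
  also have "\<dots> = (\<integral>\<^sup>+z. \<integral>\<^sup>+s. ennreal (rx_tail Pm \<Psi> (s * (Pn * z + \<eta>)) / (1 + s)) * indicator {0..} s *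
      ennreal (exp (- z)) * indicator {0..} z \<partial>lborel \<partial>lborel)"
  proof (rule nn_integral_cong)
    fix z :: real
    show "(\<integral>\<^sup>+t. \<integral>\<^sup>+x. ennreal (capacity_I Pm Pn \<Psi> \<eta> x t z) \<partial>E \<partial>E) * ennreal (exp (- z)) * indicator {0..} z =
      (\<integral>\<^sup>+s. ennreal (rx_tail Pm \<Psi> (s * (Pn * z + \<eta>)) / (1 + s)) * indicator {0..} s *
      ennreal (exp (- z)) * indicator {0..} z \<partial>lborel)"
    proof (cases "z \<ge> 0")
      case True
      then have d: "Pn * z + \<eta> > 0" using pos by (simp add: add_nonneg_pos)
      show ?thesis
        unfolding capacity_I_def SINR_I_def E_def nn_integral_ln_received_power[OF pos(1,3) d]
        by (simp add: nn_integral_multc)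
    qed auto
  qed
  also have "\<dots> = (\<integral>\<^sup>+s. \<integral>\<^sup>+z. ennreal (rx_tail Pm \<Psi> (s * (Pn * z + \<eta>)) / (1 + s)) * indicator {0..} s *
      ennreal (exp (- z)) * indicator {0..} z \<partial>lborel \<partial>lborel)"
    by (rule lborel_pair.Fubini') measurable
  also have "\<dots> = (\<integral>\<^sup>+s. ennreal ((1 - exp (- \<Psi> / Pm)) *
        (exp (- (\<eta> / Pm * s)) / ((1 + s) * (1 + s * Pn / Pm)))) * indicator {0..} s +
      ennreal (\<Psi> / Pn * exp (\<eta> / Pn) *
        (upper_Gamma 0 ((\<eta> + \<Psi> / s) * (1 / Pn + s / Pm)) *
               (exp (\<Psi> / (s * Pn)) / (s * (1 + s))))) * indicator {0..} s \<partial>lborel)"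
  \<comment> \<open>The average over \<open>z\<close> is known for s > 0 only, since its Gamma
    argument divides by \<open>s\<close>.\<close>
  proof (rule nn_integral_cong_AE, rule AE_mp[OF AE_lborel_singleton[of 0]], intro AE_I2 impI)
    fix s :: real assume "s \<noteq> 0"
    let ?A = "(1 - exp (- \<Psi> / Pm)) * (exp (- (\<eta> / Pm * s)) / (1 + s * Pn / Pm))"
    let ?B = "\<Psi> / Pn * exp (\<eta> / Pn) * (upper_Gamma 0 ((\<eta> + \<Psi> / s) * (1 / Pn + s / Pm)) *
               (exp (\<Psi> / (s * Pn)) / s))"
    show "(\<integral>\<^sup>+z. ennreal (rx_tail Pm \<Psi> (s * (Pn * z + \<eta>)) / (1 + s)) * indicator {0..} s *
      ennreal (exp (- z)) * indicator {0..} z \<partial>lborel) =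
      ennreal ((1 - exp (- \<Psi> / Pm)) *
        (exp (- (\<eta> / Pm * s)) / ((1 + s) * (1 + s * Pn / Pm)))) * indicator {0..} s +
      ennreal (\<Psi> / Pn * exp (\<eta> / Pn) *
        (upper_Gamma 0 ((\<eta> + \<Psi> / s) * (1 / Pn + s / Pm)) *
               (exp (\<Psi> / (s * Pn)) / (s * (1 + s))))) * indicator {0..} s"
    proof (cases "s > 0")
      case True
      have nonneg: "?A \<ge> 0" "?B \<ge> 0" and s1: "1 + s > 0"
        using True pos upper_Gamma_nonneg by simp_all
      note AB = nonneg[THEN divide_nonneg_pos, OF s1]
      have "(\<integral>\<^sup>+z. ennreal (rx_tail Pm \<Psi> (s * (Pn * z + \<eta>)) / (1 + s)) * indicator {0..} s *
          ennreal (exp (- z)) * indicator {0..} z \<partial>lborel) =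
        (\<integral>\<^sup>+z. ennreal (1 / (1 + s)) * (ennreal (rx_tail Pm \<Psi> (s * (Pn * z + \<eta>))) *
          ennreal (exp (- z)) * indicator {0..} z) \<partial>lborel)"
        using True by (intro nn_integral_cong) (auto simp: indicator_def ennreal_mult'[symmetric] ennreal_mult''[symmetric])
      also have "\<dots> = ennreal (1 / (1 + s)) * (\<integral>\<^sup>+z\<in>{0..}. ennreal (rx_tail Pm \<Psi> (s * (Pn * z + \<eta>))) * ennreal (exp (- z)) \<partial>lborel)"
        by (rule nn_integral_cmult) measurable
      also have "\<dots> = ennreal (1 / (1 + s)) * ennreal (?A + ?B)"
        by (subst nn_integral_rx_tail_interference[OF pos True]) simp
      also have "\<dots> = ennreal (?A / (1 + s) + ?B / (1 + s))"
        using True by (subst ennreal_mult'[symmetric]) (simp_all add: add_divide_distrib)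
      also have "\<dots> = ennreal (?A / (1 + s)) + ennreal (?B / (1 + s))"
        using AB by (rule ennreal_plus)
      finally show ?thesis using True by (simp add: mult_ac)
    qed (use \<open>s \<noteq> 0\<close> in auto)
  qed
  also have "\<dots> = (\<integral>\<^sup>+s\<in>{0..}. ennreal ((1 - exp (- \<Psi> / Pm)) *
        (exp (- (\<eta> / Pm * s)) / ((1 + s) * (1 + s * Pn / Pm)))) \<partial>lborel) +
    (\<integral>\<^sup>+s\<in>{0..}. ennreal (\<Psi> / Pn * exp (\<eta> / Pn) *
        (upper_Gamma 0 ((\<eta> + \<Psi> / s) * (1 / Pn + s / Pm)) *
               (exp (\<Psi> / (s * Pn)) / (s * (1 + s))))) \<partial>lborel)"
    by (rule nn_integral_add) measurable
  finally show ?thesis .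
qed

section \<open>Joint law of the gains and random sums\<close>

lemma UNIV_link: "UNIV = {SU_SBS, SU_PBS, PU_SBS}"
  using link.exhaust by auto

text \<open>The index set is built by nested \<open>insert\<close>s because each use of Tonelli
  makes the inserted coordinate the outermost variable; \<open>SU_SBS\<close> ends up innermost, the
  order in which the Rayleigh means are computed.\<close>

lemma nn_integral_PiM_link:
  fixes D :: "link \<Rightarrow> real measure"
  assumes D: "\<And>l. prob_space (D l)" and [measurable_cong]: "\<And>l. sets (D l) = sets borel"
    and [measurable]: "f \<in> borel_measurable (borel \<Otimes>\<^sub>M borel \<Otimes>\<^sub>M borel)"
  shows "(\<integral>\<^sup>+w. f (w SU_SBS, w SU_PBS, w PU_SBS) \<partial>PiM UNIV D) =
    (\<integral>\<^sup>+z. \<integral>\<^sup>+t. \<integral>\<^sup>+x. f (x, t, z) \<partial>D SU_SBS \<partial>D SU_PBS \<partial>D PU_SBS)"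
proof -
  interpret D: product_prob_space D UNIV
    using D by (rule product_prob_spaceI)
  have comp: "(\<lambda>w. w l) \<in> borel_measurable (PiM J D)" if "l \<in> J" for l J
    using measurable_component_singleton[OF that, of D] measurable_cong_sets[OF refl assms(2)]
    by blast
  have f: "(\<lambda>w. f (a w, b w, c w)) \<in> borel_measurable (PiM J D)"
    if "a \<in> borel_measurable (PiM J D)" "b \<in> borel_measurable (PiM J D)" "c \<in> borel_measurable (PiM J D)"
    for a b c J
    using that by measurable
  have "(\<integral>\<^sup>+w. f (w SU_SBS, w SU_PBS, w PU_SBS) \<partial>PiM (insert PU_SBS {SU_PBS, SU_SBS}) D) =
    (\<integral>\<^sup>+z. \<integral>\<^sup>+w. f (w SU_SBS, w SU_PBS, z) \<partial>PiM (insert SU_PBS {SU_SBS}) D \<partial>D PU_SBS)"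
    by (subst D.product_nn_integral_insert_rev) (simp_all add: f comp)
  also have "\<dots> = (\<integral>\<^sup>+z. \<integral>\<^sup>+t. \<integral>\<^sup>+w. f (w SU_SBS, t, z) \<partial>PiM {SU_SBS} D \<partial>D SU_PBS \<partial>D PU_SBS)"
    by (rule nn_integral_cong, subst D.product_nn_integral_insert_rev) (simp_all add: f comp)
  also have "\<dots> = (\<integral>\<^sup>+z. \<integral>\<^sup>+t. \<integral>\<^sup>+x. f (x, t, z) \<partial>D SU_SBS \<partial>D SU_PBS \<partial>D PU_SBS)"
    by (intro nn_integral_cong D.product_nn_integral_singleton[where f = "\<lambda>x. f (x, t, z)" for t z]) measurable
  also have "insert PU_SBS {SU_PBS, SU_SBS} = UNIV" by (auto simp: UNIV_link)
  finally show ?thesis .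
qed

context prob_space
begin

text \<open>Joint independence makes the law of the whole family a product measure. Its image under
  restriction to the slice l -> (l, i), an injective reindexing, is the product of the three
  marginal laws on subcarrier \<open>i\<close>.\<close>

lemma nn_integral_links:
  assumes indep: "indep_vars (\<lambda>_. borel) (channel_gain h hmp g) (UNIV \<times> I)" and i: "i \<in> I"
    and [measurable]: "f \<in> borel_measurable (borel \<Otimes>\<^sub>M borel \<Otimes>\<^sub>M borel)"
  shows "(\<integral>\<^sup>+\<omega>. f (h i \<omega>, hmp i \<omega>, g i \<omega>) \<partial>M) =
    (\<integral>\<^sup>+z. \<integral>\<^sup>+t. \<integral>\<^sup>+x. f (x, t, z) \<partial>distr M borel (h i) \<partial>distr M borel (hmp i) \<partial>distr M borel (g i))"
proof -
  let ?X = "channel_gain h hmp g"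
  have X: "p \<in> UNIV \<times> I \<Longrightarrow> ?X p \<in> borel_measurable M" for p
    using indep unfolding indep_vars_def2 by blast
  have Xi [measurable]: "?X (l, i) \<in> borel_measurable M" for l
    using X i by blast
  have joint: "distr M (PiM (UNIV \<times> I) (\<lambda>_. borel)) (\<lambda>\<omega>. \<lambda>p\<in>UNIV \<times> I. ?X p \<omega>) =
      PiM (UNIV \<times> I) (\<lambda>p. distr M borel (?X p))"
    using indep i by (subst (asm) indep_vars_iff_distr_eq_PiM') (auto intro: X)
  have "PiM UNIV (\<lambda>l. distr M borel (?X (l, i))) =
      distr (PiM (UNIV \<times> I) (\<lambda>p. distr M borel (?X p))) (PiM UNIV (\<lambda>l. distr M borel (?X (l, i))))
        (\<lambda>w. \<lambda>l\<in>UNIV. w (l, i))"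
    using i by (intro distr_PiM_reindex[symmetric] prob_space_distr X) (auto simp: inj_on_def)
  also have "\<dots> = distr (distr M (PiM (UNIV \<times> I) (\<lambda>_. borel)) (\<lambda>\<omega>. \<lambda>p\<in>UNIV \<times> I. ?X p \<omega>))
      (PiM UNIV (\<lambda>l. borel)) (\<lambda>w. \<lambda>l\<in>UNIV. w (l, i))"
    unfolding joint by (intro distr_cong refl sets_PiM_cong) auto
  also have "\<dots> = distr M (PiM UNIV (\<lambda>l. borel)) (\<lambda>\<omega> l. ?X (l, i) \<omega>)"
    using i X by (subst distr_distr) (auto simp: o_def intro!: measurable_restrict measurable_component_singleton distr_cong)
  finally have *: "PiM UNIV (\<lambda>l. distr M borel (?X (l, i))) = distr M (PiM UNIV (\<lambda>l. borel)) (\<lambda>\<omega> l. ?X (l, i) \<omega>)" .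
  have [measurable]: "(\<lambda>\<omega> l. ?X (l, i) \<omega>) \<in> M \<rightarrow>\<^sub>M PiM UNIV (\<lambda>l. borel)"
    by (rule measurable_PiM_single') auto
  have "(\<integral>\<^sup>+z. \<integral>\<^sup>+t. \<integral>\<^sup>+x. f (x, t, z) \<partial>distr M borel (?X (SU_SBS, i))
      \<partial>distr M borel (?X (SU_PBS, i)) \<partial>distr M borel (?X (PU_SBS, i))) =
    (\<integral>\<^sup>+w. f (w SU_SBS, w SU_PBS, w PU_SBS) \<partial>PiM UNIV (\<lambda>l. distr M borel (?X (l, i))))"
    by (rule nn_integral_PiM_link[symmetric]) (auto intro: prob_space_distr)
  also have "\<dots> = (\<integral>\<^sup>+\<omega>. f (h i \<omega>, hmp i \<omega>, g i \<omega>) \<partial>M)"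
    unfolding * by (subst nn_integral_distr) auto
  finally show ?thesis by simp
qed

text \<open>By \<open>nn_integral_links\<close> the marginals determine the law of the triple. This
  makes every function of the three gains, in particular either capacity, identically distributed
  over the subcarriers.\<close>

lemma distr_links_eq:
  assumes indep: "indep_vars (\<lambda>_. borel) (channel_gain h hmp g) (UNIV \<times> I)" and ij: "i \<in> I" "j \<in> I"
    and ident: "\<And>l. distr M borel (channel_gain h hmp g (l, i)) = distr M borel (channel_gain h hmp g (l, j))"
  shows "distr M (borel \<Otimes>\<^sub>M borel \<Otimes>\<^sub>M borel) (\<lambda>\<omega>. (h i \<omega>, hmp i \<omega>, g i \<omega>)) =
    distr M (borel \<Otimes>\<^sub>M borel \<Otimes>\<^sub>M borel) (\<lambda>\<omega>. (h j \<omega>, hmp j \<omega>, g j \<omega>))"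
proof (rule measure_eqI)
  have X: "channel_gain h hmp g (l, k) \<in> borel_measurable M" if "k \<in> I" for l k
    using indep that unfolding indep_vars_def2 by blast
  have meas: "(\<lambda>\<omega>. (h k \<omega>, hmp k \<omega>, g k \<omega>)) \<in> M \<rightarrow>\<^sub>M borel \<Otimes>\<^sub>M borel \<Otimes>\<^sub>M borel" if "k \<in> I" for k
    using X[OF that, of SU_SBS] X[OF that, of SU_PBS] X[OF that, of PU_SBS] by simp
  fix A
  assume "A \<in> sets (distr M (borel \<Otimes>\<^sub>M borel \<Otimes>\<^sub>M borel) (\<lambda>\<omega>. (h i \<omega>, hmp i \<omega>, g i \<omega>)))"
  then have A [measurable]: "A \<in> sets (borel \<Otimes>\<^sub>M borel \<Otimes>\<^sub>M borel)" by simp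
  have "emeasure (distr M (borel \<Otimes>\<^sub>M borel \<Otimes>\<^sub>M borel) (\<lambda>\<omega>. (h k \<omega>, hmp k \<omega>, g k \<omega>))) A =
     (\<integral>\<^sup>+z. \<integral>\<^sup>+t. \<integral>\<^sup>+x. indicator A (x, t, z) \<partial>distr M borel (h k) \<partial>distr M borel (hmp k) \<partial>distr M borel (g k))"
    if k: "k \<in> I" for k
  proof -
    have "emeasure (distr M (borel \<Otimes>\<^sub>M borel \<Otimes>\<^sub>M borel) (\<lambda>\<omega>. (h k \<omega>, hmp k \<omega>, g k \<omega>))) A =
      (\<integral>\<^sup>+y. indicator A y \<partial>distr M (borel \<Otimes>\<^sub>M borel \<Otimes>\<^sub>M borel) (\<lambda>\<omega>. (h k \<omega>, hmp k \<omega>, g k \<omega>)))"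
      using A by (intro nn_integral_indicator[symmetric]) simp
    also have "\<dots> = (\<integral>\<^sup>+\<omega>. indicator A (h k \<omega>, hmp k \<omega>, g k \<omega>) \<partial>M)"
      using A by (intro nn_integral_distr[OF meas[OF k]]) simp
    finally show ?thesis
      by (simp add: nn_integral_links[OF indep k])
  qed
  with ij ident[of SU_SBS] ident[of SU_PBS] ident[of PU_SBS]
  show "emeasure (distr M (borel \<Otimes>\<^sub>M borel \<Otimes>\<^sub>M borel) (\<lambda>\<omega>. (h i \<omega>, hmp i \<omega>, g i \<omega>))) A =
    emeasure (distr M (borel \<Otimes>\<^sub>M borel \<Otimes>\<^sub>M borel) (\<lambda>\<omega>. (h j \<omega>, hmp j \<omega>, g j \<omega>))) A"
    by simp
qed simp

text \<open>A function of \<open>X\<close> generates a sub-sigma-algebra of the one generated by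
  \<open>X\<close>. The two variables of \<open>indep_var\<close> share a value type, whereas the
  choice is set-valued and the gains form a function; so independence starts at the level of
  sigma-algebras and becomes \<open>indep_var\<close> after composition.\<close>

lemma indep_var_vimage_algebra:
  assumes indep: "indep_set (sets (vimage_algebra (space M) X S)) (sets (vimage_algebra (space M) Y T))"
    and X: "X \<in> M \<rightarrow>\<^sub>M S" and Y: "Y \<in> M \<rightarrow>\<^sub>M T"
    and f: "f \<in> S \<rightarrow>\<^sub>M N" and k: "k \<in> T \<rightarrow>\<^sub>M N'"
  shows "indep_var N (\<lambda>\<omega>. f (X \<omega>)) N' (\<lambda>\<omega>. k (Y \<omega>))"
proof -
  have sub: "sigma_sets (space M) {(\<lambda>\<omega>. j (Z \<omega>)) -` A \<inter> space M | A. A \<in> sets L} \<subseteq>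
      sets (vimage_algebra (space M) Z R)"
    if Z: "Z \<in> M \<rightarrow>\<^sub>M R" and j: "j \<in> R \<rightarrow>\<^sub>M L" for Z :: "'a \<Rightarrow> 'x" and R and j :: "'x \<Rightarrow> 'y" and L
  proof -
    have "Z \<in> vimage_algebra (space M) Z R \<rightarrow>\<^sub>M R"
      by (rule measurable_vimage_algebra1) (use measurable_space[OF Z] in auto)
    then have "(\<lambda>\<omega>. j (Z \<omega>)) \<in> vimage_algebra (space M) Z R \<rightarrow>\<^sub>M L"
      using j by (rule measurable_compose)
    from measurable_sets[OF this]
    have "{(\<lambda>\<omega>. j (Z \<omega>)) -` A \<inter> space M | A. A \<in> sets L} \<subseteq> sets (vimage_algebra (space M) Z R)"
      by auto
    from sets.sigma_sets_subset[OF this] show ?thesis by simp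
  qed
  have "indep_set (sigma_sets (space M) {(\<lambda>\<omega>. f (X \<omega>)) -` A \<inter> space M | A. A \<in> sets N})
     (sigma_sets (space M) {(\<lambda>\<omega>. k (Y \<omega>)) -` A \<inter> space M | A. A \<in> sets N'})"
    unfolding indep_set_def
  proof (rule indep_sets_mono_sets[OF indep[unfolded indep_set_def]])
    fix i :: bool
    show "(case i of
        True \<Rightarrow> sigma_sets (space M) {(\<lambda>\<omega>. f (X \<omega>)) -` A \<inter> space M | A. A \<in> sets N}
      | False \<Rightarrow> sigma_sets (space M) {(\<lambda>\<omega>. k (Y \<omega>)) -` A \<inter> space M | A. A \<in> sets N'}) \<subseteq>
      (case i of True \<Rightarrow> sets (vimage_algebra (space M) X S) | False \<Rightarrow> sets (vimage_algebra (space M) Y T))"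
      using sub[OF X f] sub[OF Y k] by (cases i) simp_all
  qed
  then show ?thesis
    unfolding indep_var_eq using measurable_compose[OF X f] measurable_compose[OF Y k] by blast
qed

text \<open>The random upper limit is traded for the weights \<open>?b i\<close> on a fixed range,
  so that expectation is linear. Each weight is a function of \<open>N\<close> alone, hence
  independent of \<open>X i\<close>, and its mean factors off.\<close>

lemma
  fixes X :: "nat \<Rightarrow> 'a \<Rightarrow> real" and N :: "'a \<Rightarrow> nat"
  assumes indep: "\<And>i. i \<in> {1..n} \<Longrightarrow> indep_var borel (\<lambda>\<omega>. real (N \<omega>)) borel (X i)"
    and int: "\<And>i. i \<in> {1..n} \<Longrightarrow> integrable M (X i)"
    and mean: "\<And>i. i \<in> {1..n} \<Longrightarrow> expectation (X i) = \<mu>"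
    and le: "\<And>\<omega>. \<omega> \<in> space M \<Longrightarrow> N \<omega> \<le> n"
    and N [measurable]: "N \<in> M \<rightarrow>\<^sub>M count_space UNIV"
  shows integrable_random_sum: "integrable M (\<lambda>\<omega>. \<Sum>i=1..N \<omega>. X i \<omega>)" (is ?I)
    and expectation_random_sum: "expectation (\<lambda>\<omega>. \<Sum>i=1..N \<omega>. X i \<omega>) = expectation (\<lambda>\<omega>. real (N \<omega>)) * \<mu>" (is ?E)
proof -
  let ?b = "\<lambda>i \<omega>. if i \<le> N \<omega> then 1 else 0 :: real"
  have b: "integrable M (?b i)" for i
    by (rule integrable_const_bound[of _ 1]) auto
  have ind: "indep_var borel (?b i) borel (X i)" if "i \<in> {1..n}" for i
  proof -
    have "indep_var borel ((\<lambda>r. if real i \<le> r then 1 else 0 :: real) \<circ> (\<lambda>\<omega>. real (N \<omega>))) borel ((\<lambda>x. x) \<circ> X i)"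
      by (rule indep_var_compose[OF indep[OF that]]) measurable
    then show ?thesis unfolding o_def of_nat_le_iff .
  qed
  have sum: "(\<Sum>i=1..N \<omega>. f i) = (\<Sum>i=1..n. ?b i \<omega> * f i)" if "\<omega> \<in> space M" for \<omega> and f :: "nat \<Rightarrow> real"
    using le[OF that] by (intro sum.mono_neutral_cong_left) auto
  have int': "integrable M (\<lambda>\<omega>. \<Sum>i=1..n. ?b i \<omega> * X i \<omega>)"
    by (intro Bochner_Integration.integrable_sum indep_var_integrable[OF ind b int])
  then show ?I
    by (subst Bochner_Integration.integrable_cong[OF refl sum]) auto
  have "expectation (\<lambda>\<omega>. \<Sum>i=1..N \<omega>. X i \<omega>) = expectation (\<lambda>\<omega>. \<Sum>i=1..n. ?b i \<omega> * X i \<omega>)"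
    by (rule Bochner_Integration.integral_cong[OF refl sum])
  also have "\<dots> = (\<Sum>i=1..n. expectation (\<lambda>\<omega>. ?b i \<omega> * X i \<omega>))"
    by (intro Bochner_Integration.integral_sum indep_var_integrable[OF ind b int])
  also have "\<dots> = (\<Sum>i=1..n. expectation (?b i) * \<mu>)"
    by (intro sum.cong refl) (simp add: indep_var_lebesgue_integral[OF ind b int] mean)
  also have "\<dots> = expectation (\<lambda>\<omega>. \<Sum>i=1..n. ?b i \<omega> * 1) * \<mu>"
    by (subst Bochner_Integration.integral_sum) (auto intro: b simp: sum_distrib_right)
  \<comment> \<open>The weights add up to \<open>N\<close>: this is \<open>sum\<close> for the
    constant sequence 1.\<close>
  also have "expectation (\<lambda>\<omega>. \<Sum>i=1..n. ?b i \<omega> * 1) = expectation (\<lambda>\<omega>. real (N \<omega>))"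
    by (rule Bochner_Integration.integral_cong[OF refl], subst sum[symmetric]) auto
  finally show ?E .
qed

end

section \<open>The number of collisions\<close>

lemma finite_subcarrier_sets: "finite (subcarrier_sets F s)"
  unfolding subcarrier_sets_def by (rule finite_subset[of _ "Pow {1..F}"]) auto

lemma card_subcarrier_sets: "card (subcarrier_sets F s) = F choose s"
  unfolding subcarrier_sets_def by (subst n_subsets) auto

text \<open>Says that a fixed subcarrier is picked with probability s / F, cleared of denominators.
  Counting the choices that avoid \<open>u\<close> leads to the absorption identity F * C(F-1, s) =
  (F - s) * C(F, s), which has no s - 1 and so covers s = 0.\<close>

lemma card_subcarrier_sets_containing:
  assumes "u \<in> {1..F}" "s \<le> F"
  shows "F * card {K \<in> subcarrier_sets F s. u \<in> K} = s * (F choose s)"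
proof -
  have "{K \<in> subcarrier_sets F s. u \<notin> K} = {K. K \<subseteq> {1..F} - {u} \<and> card K = s}"
    by (auto simp: subcarrier_sets_def)
  then have "card {K \<in> subcarrier_sets F s. u \<notin> K} = (F - 1) choose s"
    using assms by (simp add: n_subsets)
  moreover have "card {K \<in> subcarrier_sets F s. u \<in> K} + card {K \<in> subcarrier_sets F s. u \<notin> K} =
      card (subcarrier_sets F s)"
    by (subst card_Un_disjoint[symmetric])
      (auto intro!: arg_cong[where f = card] finite_subset[OF _ finite_subcarrier_sets[of F s]])
  ultimately have "F * card {K \<in> subcarrier_sets F s. u \<in> K} + F * ((F - 1) choose s) = F * (F choose s)"
    by (simp add: card_subcarrier_sets add_mult_distrib2[symmetric])
  moreover have "F * ((F - 1) choose s) = (F - s) * (F choose s)"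
    by (rule binomial_absorb_comp[symmetric])
  moreover have "F * (F choose s) = s * (F choose s) + (F - s) * (F choose s)"
    using assms by (simp add: add_mult_distrib[symmetric])
  ultimately show ?thesis by simp
qed

text \<open>The incidences between choices and subcarriers of \<open>U\<close> are grouped by
  subcarrier, each of which lies in equally many choices.\<close>

lemma sum_collisions:
  assumes "U \<subseteq> {1..F}" "s \<le> F"
  shows "F * (\<Sum>K\<in>subcarrier_sets F s. card (K \<inter> U)) = card U * s * (F choose s)"
proof -
  have fin: "finite U" using assms finite_subset by blast
  have "(\<Sum>K\<in>subcarrier_sets F s. card (K \<inter> U)) = (\<Sum>K\<in>subcarrier_sets F s. \<Sum>u\<in>U. if u \<in> K then 1 else 0)"
    using fin by (intro sum.cong refl) (simp add: sum.If_cases Int_commute)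
  also have "\<dots> = (\<Sum>u\<in>U. \<Sum>K\<in>subcarrier_sets F s. if u \<in> K then 1 else 0)"
    by (rule sum.swap)
  also have "\<dots> = (\<Sum>u\<in>U. card {K \<in> subcarrier_sets F s. u \<in> K})"
    by (intro sum.cong refl) (simp add: sum.If_cases finite_subcarrier_sets Int_def)
  finally have "F * (\<Sum>K\<in>subcarrier_sets F s. card (K \<inter> U)) = (\<Sum>u\<in>U. F * card {K \<in> subcarrier_sets F s. u \<in> K})"
    by (simp add: sum_distrib_left)
  also have "\<dots> = (\<Sum>u\<in>U. s * (F choose s))"
    using assms by (intro sum.cong refl card_subcarrier_sets_containing) auto
  finally show ?thesis by simp
qed

section \<open>The mean capacity with collisions, and its closed forms under Rayleigh fading\<close>

theorem theorem1:
  fixes M :: "'a measure"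
    and F FS FP :: nat
    and U :: "nat set"
    and K :: "'a \<Rightarrow> nat set"
    and Pm Pn \<Psi> \<eta> :: real
    and h hmp g :: "nat \<Rightarrow> 'a \<Rightarrow> real"
    and CI CNI :: "nat \<Rightarrow> 'a \<Rightarrow> real"
    and C1 :: "'a \<Rightarrow> real"
  assumes "prob_space M"
    and "Pm > 0" "Pn > 0" "\<Psi> > 0" "\<eta> > 0"
    and "U \<subseteq> {1..F}" "card U = FP" "FS \<le> F"
    and gains_indep: "prob_space.indep_vars M (\<lambda>_. borel) (channel_gain h hmp g) (UNIV \<times> {1..F})"
    and gains_pos: "\<And>l i. i \<in> {1..F} \<Longrightarrow> AE \<omega> in M. channel_gain h hmp g (l, i) \<omega> > 0"
    and gains_ident: "\<And>l i j. i \<in> {1..F} \<Longrightarrow> j \<in> {1..F} \<Longrightarrow>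
      distr M borel (channel_gain h hmp g (l, i)) = distr M borel (channel_gain h hmp g (l, j))"
    and choice_measurable: "K \<in> measurable M (count_space (subcarrier_sets F FS))"
    and choice_uniform: "distr M (count_space (subcarrier_sets F FS)) K =
      uniform_count_measure (subcarrier_sets F FS)"
    and choice_indep: "prob_space.indep_set M
      (sets (vimage_algebra (space M) K (count_space (subcarrier_sets F FS))))
      (sets (vimage_algebra (space M)
        (\<lambda>\<omega>. \<lambda>p\<in>UNIV \<times> {1..F}. channel_gain h hmp g p \<omega>)
        (Pi\<^sub>M (UNIV \<times> {1..F}) (\<lambda>_. borel))))"
    and CI_def: "\<And>i \<omega>. CI i \<omega> = capacity_I Pm Pn \<Psi> \<eta> (h i \<omega>) (hmp i \<omega>) (g i \<omega>)"
    and CNI_def: "\<And>i \<omega>. CNI i \<omega> = capacity_NI Pm \<Psi> \<eta> (h i \<omega>) (hmp i \<omega>)"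
    and C1_def: "\<And>\<omega>. C1 \<omega> = SU_capacity U (K \<omega>) (\<lambda>i. CI i \<omega>) (\<lambda>i. CNI i \<omega>)"
  shows
    "(\<forall>i\<in>{1..F}. integrable M (CNI i) \<longrightarrow>
        integrable M (CI i) \<and> integrable M C1 \<and>
        (\<integral>\<omega>. C1 \<omega> \<partial>M) =
          real FS / real F *
            (real FP * ((\<integral>\<omega>. CI i \<omega> \<partial>M) - (\<integral>\<omega>. CNI i \<omega> \<partial>M)) + real F * (\<integral>\<omega>. CNI i \<omega> \<partial>M)))
     \<and>
     ((\<forall>l. \<forall>i\<in>{1..F}. distributed M lborel (channel_gain h hmp g (l, i)) (exponential_density 1)) \<longrightarrow>
      (\<forall>i\<in>{1..F}.
        integrable M (CI i) \<and> integrable M (CNI i) \<and>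
        set_integrable lborel {0<..}
          (\<lambda>x. upper_Gamma 0 ((\<eta> + \<Psi> / x) * (1 / Pn + x / Pm)) *
               (exp (\<Psi> / (x * Pn)) / (x * (1 + x)))) \<and>
        (Pm \<noteq> Pn \<longrightarrow>
          (\<integral>\<omega>. CI i \<omega> \<partial>M) =
            (1 - exp (- \<Psi> / Pm)) / (1 - Pn / Pm) *
              (upper_Gamma 0 (\<eta> / Pm) * exp (\<eta> / Pm) - upper_Gamma 0 (\<eta> / Pn) * exp (\<eta> / Pn))
            + \<Psi> / Pn * exp (\<eta> / Pn) *
              (LINT x:{0<..}|lborel.
                 upper_Gamma 0 ((\<eta> + \<Psi> / x) * (1 / Pn + x / Pm)) *
                 (exp (\<Psi> / (x * Pn)) / (x * (1 + x))))) \<and>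
        (\<Psi> \<noteq> \<eta> \<longrightarrow>
          (\<integral>\<omega>. CNI i \<omega> \<partial>M) =
            upper_Gamma 0 (\<eta> / Pm) * exp (\<eta> / Pm) * (1 + exp (- \<Psi> / Pm) * \<eta> / (\<Psi> - \<eta>))
            + \<Psi> / (\<eta> - \<Psi>) * upper_Gamma 0 (\<Psi> / Pm))))"
proof -
  interpret prob_space M by fact
  note pos = \<open>Pm > 0\<close> \<open>Pn > 0\<close> \<open>\<Psi> > 0\<close> \<open>\<eta> > 0\<close>
  let ?X = "channel_gain h hmp g" and ?S = "subcarrier_sets F FS"
  have gain [measurable]: "h i \<in> borel_measurable M" "hmp i \<in> borel_measurable M" "g i \<in> borel_measurable M"
    if "i \<in> {1..F}" for i
  proof -
    have "?X (l, i) \<in> borel_measurable M" for l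
      using gains_indep that unfolding indep_vars_def2 by blast
    from this[of SU_SBS] this[of SU_PBS] this[of PU_SBS]
    show "h i \<in> borel_measurable M" "hmp i \<in> borel_measurable M" "g i \<in> borel_measurable M"
      by simp_all
  qed
  have CI_eq: "CI i = (\<lambda>\<omega>. capacity_I Pm Pn \<Psi> \<eta> (h i \<omega>) (hmp i \<omega>) (g i \<omega>))" for i
    using CI_def by blast
  have CNI_eq: "CNI i = (\<lambda>\<omega>. capacity_NI Pm \<Psi> \<eta> (h i \<omega>) (hmp i \<omega>))" for i
    using CNI_def by blast
  have CI_meas: "CI i \<in> borel_measurable M" and CNI_meas: "CNI i \<in> borel_measurable M"
    if i: "i \<in> {1..F}" for i
    unfolding CI_eq CNI_eq using gain[OF i] by measurable
  have bounds: "AE \<omega> in M. 0 \<le> CI i \<omega> \<and> CI i \<omega> \<le> CNI i \<omega>" if i: "i \<in> {1..F}" for i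
    using gains_pos[OF i, of SU_SBS] gains_pos[OF i, of SU_PBS] gains_pos[OF i, of PU_SBS]
  proof eventually_elim
    case (elim \<omega>)
    then show ?case
      using capacity_bounds[OF pos, of "h i \<omega>" "hmp i \<omega>" "g i \<omega>"] by (simp add: CI_def CNI_def)
  qed
  have CI_int: "integrable M (CI i)" if i: "i \<in> {1..F}" and int: "integrable M (CNI i)" for i
  proof (rule Bochner_Integration.integrable_bound[OF int CI_meas[OF i]])
    show "AE \<omega> in M. norm (CI i \<omega>) \<le> norm (CNI i \<omega>)"
      using bounds[OF i] by eventually_elim simp
  qed

  have part1: "integrable M (CI i) \<and> integrable M C1 \<and>
        (\<integral>\<omega>. C1 \<omega> \<partial>M) =
          real FS / real F *
            (real FP * ((\<integral>\<omega>. CI i \<omega> \<partial>M) - (\<integral>\<omega>. CNI i \<omega> \<partial>M)) + real F * (\<integral>\<omega>. CNI i \<omega> \<partial>M))"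
    if i: "i \<in> {1..F}" and int: "integrable M (CNI i)" for i
  proof -
    let ?B = "borel \<Otimes>\<^sub>M borel \<Otimes>\<^sub>M borel :: (real \<times> real \<times> real) measure"
    let ?G = "\<lambda>j \<omega>. (h j \<omega>, hmp j \<omega>, g j \<omega>)"
    have Gm: "?G j \<in> M \<rightarrow>\<^sub>M ?B" if "j \<in> {1..F}" for j
      using gain[OF that] by measurable
    \<comment> \<open>The sums in \<open>C1\<close> run over the indices 1, 2, ..., while the
      formula refers to one arbitrary \<open>i\<close>; equality of laws replaces every index by
      \<open>i\<close>.\<close>
    have same_law: "(integrable M (\<lambda>\<omega>. f (?G j \<omega>)) \<longleftrightarrow> integrable M (\<lambda>\<omega>. f (?G i \<omega>))) \<and>
        (\<integral>\<omega>. f (?G j \<omega>) \<partial>M) = (\<integral>\<omega>. f (?G i \<omega>) \<partial>M)"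
      if j: "j \<in> {1..F}" and f: "f \<in> borel_measurable ?B" for j and f :: "real \<times> real \<times> real \<Rightarrow> real"
      using integrable_distr_eq[OF Gm[OF i] f] integrable_distr_eq[OF Gm[OF j] f]
        integral_distr[OF Gm[OF i] f] integral_distr[OF Gm[OF j] f]
      unfolding distr_links_eq[OF gains_indep i j gains_ident[OF i j]] by simp
    have fI: "(\<lambda>(x, t, z). capacity_I Pm Pn \<Psi> \<eta> x t z) \<in> borel_measurable ?B"
      and fN: "(\<lambda>(x, t, z). capacity_NI Pm \<Psi> \<eta> x t) \<in> borel_measurable ?B"
      by measurable
    have CNI_j: "integrable M (CNI j)" "expectation (CNI j) = expectation (CNI i)" if j: "j \<in> {1..F}" for j
      using same_law[OF j fN] int by (simp_all add: CNI_eq)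
    have CI_j: "integrable M (CI j)" "expectation (CI j) = expectation (CI i)" if j: "j \<in> {1..F}" for j
      using same_law[OF j fI] CI_int[OF i int] by (simp_all add: CI_eq)

    let ?PM = "Pi\<^sub>M (UNIV \<times> {1..F}) (\<lambda>_. borel) :: (link \<times> nat \<Rightarrow> real) measure"
    have PM: "(\<lambda>\<omega>. \<lambda>p\<in>UNIV \<times> {1..F}. ?X p \<omega>) \<in> M \<rightarrow>\<^sub>M ?PM"
      using gains_indep unfolding indep_vars_def2 by (intro measurable_restrict) blast
    note indep = indep_var_vimage_algebra[OF choice_indep choice_measurable PM]
    have comp: "(\<lambda>w. w (l, j)) \<in> borel_measurable ?PM" if "j \<in> {1..F}" for l j
      using that by (intro measurable_component_singleton) auto
    \<comment> \<open>With \<open>N\<close> arbitrary, any count computed from the chosen set is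
      covered.\<close>
    have indep_CI: "indep_var borel (\<lambda>\<omega>. real (N (K \<omega>))) borel (CI j)" if j: "j \<in> {1..F}" for j and N :: "nat set \<Rightarrow> nat"
    proof -
      have "(\<lambda>w. capacity_I Pm Pn \<Psi> \<eta> (w (SU_SBS, j)) (w (SU_PBS, j)) (w (PU_SBS, j))) \<in> borel_measurable ?PM"
        by (intro capacity_I_measurable comp j)
      from indep[OF _ this, of "\<lambda>A. real (N A)" borel] show ?thesis using j by (simp add: CI_eq)
    qed
    have indep_CNI: "indep_var borel (\<lambda>\<omega>. real (N (K \<omega>))) borel (CNI j)" if j: "j \<in> {1..F}" for j and N :: "nat set \<Rightarrow> nat"
    proof -
      have "(\<lambda>w. capacity_NI Pm \<Psi> \<eta> (w (SU_SBS, j)) (w (SU_PBS, j))) \<in> borel_measurable ?PM"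
        by (intro capacity_NI_measurable comp j)
      from indep[OF _ this, of "\<lambda>A. real (N A)" borel] show ?thesis using j by (simp add: CNI_eq)
    qed
    have N_meas: "(\<lambda>\<omega>. N (K \<omega>)) \<in> M \<rightarrow>\<^sub>M count_space UNIV" for N :: "nat set \<Rightarrow> nat"
      using choice_measurable by (rule measurable_compose) simp

    have K: "K \<omega> \<subseteq> {1..F}" "card (K \<omega>) = FS" if "\<omega> \<in> space M" for \<omega>
      using measurable_space[OF choice_measurable that] by (auto simp: subcarrier_sets_def)
    have finU: "finite U" using \<open>U \<subseteq> {1..F}\<close> finite_subset by blast
    have kn_le: "card (K \<omega> \<inter> U) \<le> FS" if "\<omega> \<in> space M" for \<omega>
      using K[OF that] card_mono[of "K \<omega>" "K \<omega> \<inter> U"] finite_subset[of "K \<omega>" "{1..F}"] by auto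
    have F0: "real F > 0" using i by simp
    have mean_kn: "expectation (\<lambda>\<omega>. real (card (K \<omega> \<inter> U))) = real FS * real FP / real F"
    proof -
      have "expectation (\<lambda>\<omega>. real (card (K \<omega> \<inter> U))) =
          (\<integral>A. real (card (A \<inter> U)) \<partial>distr M (count_space ?S) K)"
        using choice_measurable by (subst integral_distr) auto
      also have "\<dots> = (\<Sum>A\<in>?S. real (card (A \<inter> U))) / real (F choose FS)"
        unfolding choice_uniform
        by (subst integral_uniform_count_measure) (simp_all add: finite_subcarrier_sets card_subcarrier_sets)
      also have "\<dots> = real FS * real FP / real F"
      proof -
        have "real F * (\<Sum>A\<in>?S. real (card (A \<inter> U))) = real FP * real FS * real (F choose FS)"
          using arg_cong[OF sum_collisions[OF \<open>U \<subseteq> {1..F}\<close> \<open>FS \<le> F\<close>], of real] \<open>card U = FP\<close> by simp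
        moreover have "real (F choose FS) > 0" using \<open>FS \<le> F\<close> by simp
        ultimately show ?thesis using F0 by (simp add: field_simps)
      qed
      finally show ?thesis .
    qed
    have kn_int: "integrable M (\<lambda>\<omega>. real (card (K \<omega> \<inter> U)))"
    proof (rule integrable_const_bound[of _ "real FS"])
      show "AE \<omega> in M. norm (real (card (K \<omega> \<inter> U))) \<le> real FS"
        using kn_le by (intro AE_I2) simp
      show "(\<lambda>\<omega>. real (card (K \<omega> \<inter> U))) \<in> borel_measurable M"
        using N_meas[of "\<lambda>A. card (A \<inter> U)"] by measurable
    qed
    \<comment> \<open>The subtraction is one of natural numbers; it agrees with the real difference
      because \<open>kn_le\<close> rules out truncation.\<close>
    have mean_kf: "expectation (\<lambda>\<omega>. real (card (K \<omega>) - card (K \<omega> \<inter> U))) = real FS - real FS * real FP / real F"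
    proof -
      have "expectation (\<lambda>\<omega>. real (card (K \<omega>) - card (K \<omega> \<inter> U))) =
          expectation (\<lambda>\<omega>. real FS - real (card (K \<omega> \<inter> U)))"
        using K kn_le by (intro Bochner_Integration.integral_cong refl) (simp add: of_nat_diff)
      then show ?thesis by (simp add: kn_int mean_kn prob_space)
    qed
    \<comment> \<open>Keeps both sums inside \<open>{1..F}\<close>, the indices whose gains the
      hypotheses govern.\<close>
    have le: "card (K \<omega> \<inter> U) \<le> F" "card (K \<omega>) - card (K \<omega> \<inter> U) \<le> F" if "\<omega> \<in> space M" for \<omega>
      using kn_le[OF that] K[OF that] \<open>FS \<le> F\<close> by auto
    note sums = integrable_random_sum expectation_random_sum
    note I = sums[where n = F and X = CI and N = "\<lambda>\<omega>. card (K \<omega> \<inter> U)" and \<mu> = "expectation (CI i)",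
        OF indep_CI CI_j le(1) N_meas]
    note NI = sums[where n = F and X = CNI and N = "\<lambda>\<omega>. card (K \<omega>) - card (K \<omega> \<inter> U)" and \<mu> = "expectation (CNI i)",
        OF indep_CNI CNI_j le(2) N_meas]
    have C1: "C1 = (\<lambda>\<omega>. (\<Sum>j=1..card (K \<omega> \<inter> U). CI j \<omega>) + (\<Sum>j=1..card (K \<omega>) - card (K \<omega> \<inter> U). CNI j \<omega>))"
      by (simp add: fun_eq_iff C1_def SU_capacity_def Let_def)
    have "integrable M C1"
      unfolding C1 by (intro Bochner_Integration.integrable_add I(1) NI(1))
    moreover have "expectation C1 = real FS * real FP / real F * expectation (CI i) +
        (real FS - real FS * real FP / real F) * expectation (CNI i)"
      unfolding C1 by (subst Bochner_Integration.integral_add[OF I(1) NI(1)]) (simp_all only: I(2) NI(2) mean_kn mean_kf)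
    moreover have "\<dots> = real FS / real F *
            (real FP * (expectation (CI i) - expectation (CNI i)) + real F * expectation (CNI i))"
      using F0 by (simp add: field_simps)
    ultimately show ?thesis using CI_int[OF i int] by simp
  qed

  have part2: "integrable M (CI i) \<and> integrable M (CNI i) \<and>
        set_integrable lborel {0<..}
          (\<lambda>x. upper_Gamma 0 ((\<eta> + \<Psi> / x) * (1 / Pn + x / Pm)) *
               (exp (\<Psi> / (x * Pn)) / (x * (1 + x)))) \<and>
        (Pm \<noteq> Pn \<longrightarrow>
          (\<integral>\<omega>. CI i \<omega> \<partial>M) =
            (1 - exp (- \<Psi> / Pm)) / (1 - Pn / Pm) *
              (upper_Gamma 0 (\<eta> / Pm) * exp (\<eta> / Pm) - upper_Gamma 0 (\<eta> / Pn) * exp (\<eta> / Pn))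
            + \<Psi> / Pn * exp (\<eta> / Pn) *
              (LINT x:{0<..}|lborel.
                 upper_Gamma 0 ((\<eta> + \<Psi> / x) * (1 / Pn + x / Pm)) *
                 (exp (\<Psi> / (x * Pn)) / (x * (1 + x))))) \<and>
        (\<Psi> \<noteq> \<eta> \<longrightarrow>
          (\<integral>\<omega>. CNI i \<omega> \<partial>M) =
            upper_Gamma 0 (\<eta> / Pm) * exp (\<eta> / Pm) * (1 + exp (- \<Psi> / Pm) * \<eta> / (\<Psi> - \<eta>))
            + \<Psi> / (\<eta> - \<Psi>) * upper_Gamma 0 (\<Psi> / Pm))"
    if exp_dist: "\<forall>l. \<forall>i\<in>{1..F}. distributed M lborel (?X (l, i)) (exponential_density 1)"
      and i: "i \<in> {1..F}" for i
  proof -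
    let ?E = "density lborel (exponential_density 1)"
    interpret E: prob_space ?E
      by (rule prob_space_exponential_density) simp
    let ?J = "\<lambda>x. upper_Gamma 0 ((\<eta> + \<Psi> / x) * (1 / Pn + x / Pm)) * (exp (\<Psi> / (x * Pn)) / (x * (1 + x)))"
    let ?T = "\<lambda>s. rx_tail Pm \<Psi> (s * \<eta>) / (1 + s)"
    let ?R = "\<lambda>s. exp (- (\<eta> / Pm * s)) / ((1 + s) * (1 + s * Pn / Pm))"
    let ?e = "1 - exp (- \<Psi> / Pm)" and ?c = "\<Psi> / Pn * exp (\<eta> / Pn)"
    have c: "?e \<ge> 0" "?c > 0" using pos by simp_all
    have "distr M borel (?X (l, i)) = ?E" for l
    proof -
      have "distr M borel (?X (l, i)) = distr M lborel (?X (l, i))"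
        by (rule distr_cong) auto
      then show ?thesis
        using exp_dist i by (simp add: distributed_distr_eq_density)
    qed
    from this[of SU_SBS] this[of SU_PBS] this[of PU_SBS]
    have law: "distr M borel (h i) = ?E" "distr M borel (hmp i) = ?E" "distr M borel (g i) = ?E"
      by simp_all

    have NI: "(\<integral>\<^sup>+\<omega>. ennreal (CNI i \<omega>) \<partial>M) = (\<integral>\<^sup>+s\<in>{0..}. ennreal (?T s) \<partial>lborel)"
    proof -
      have "(\<integral>\<^sup>+\<omega>. ennreal (CNI i \<omega>) \<partial>M) =
        (\<integral>\<^sup>+z. \<integral>\<^sup>+t. \<integral>\<^sup>+x. ennreal (capacity_NI Pm \<Psi> \<eta> x t) \<partial>?E \<partial>?E \<partial>?E)"
        using nn_integral_links[OF gains_indep i, of "\<lambda>(x, t, z). ennreal (capacity_NI Pm \<Psi> \<eta> x t)"]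
        by (simp add: law CNI_eq)
      \<comment> \<open>The integrand is constant in the interfering gain \<open>z\<close>, so the
        outermost integral contributes the total mass 1.\<close>
      also have "\<dots> = (\<integral>\<^sup>+s\<in>{0..}. ennreal (?T s) \<partial>lborel)"
        unfolding capacity_NI_def SNR_NI_def nn_integral_ln_received_power[OF pos(1,3,4)]
        using E.emeasure_space_1 by simp
      finally show ?thesis .
    qed
    have CNI_nonneg: "AE \<omega> in M. 0 \<le> CNI i \<omega>" using bounds[OF i] by eventually_elim simp
    have CI_nonneg: "AE \<omega> in M. 0 \<le> CI i \<omega>" using bounds[OF i] by eventually_elim simp
    have CNI_int: "integrable M (CNI i)"
      using nn_integral_rx_tail_finite[OF pos(1,3,4)] CNI_meas[OF i] CNI_nonneg
      by (intro integrableI_nonneg) (simp_all add: NI)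
    note CI_int = CI_int[OF i CNI_int]
    have NI_val: "expectation (CNI i) = upper_Gamma 0 (\<eta> / Pm) * exp (\<eta> / Pm) * (1 + exp (- \<Psi> / Pm) * \<eta> / (\<Psi> - \<eta>))
            + \<Psi> / (\<eta> - \<Psi>) * upper_Gamma 0 (\<Psi> / Pm)" if ne: "\<Psi> \<noteq> \<eta>"
    proof -
      note T = has_bochner_integral_rx_tail[OF pos(1,3,4) ne]
      have "expectation (CNI i) = enn2real (\<integral>\<^sup>+s\<in>{0..}. ennreal (?T s) \<partial>lborel)"
        using CNI_nonneg CNI_int by (simp add: integral_eq_nn_integral NI[symmetric])
      also have "(\<integral>\<^sup>+s\<in>{0..}. ennreal (?T s) \<partial>lborel) = (\<integral>\<^sup>+s. ennreal (indicator {0..} s * ?T s) \<partial>lborel)"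
        by (intro nn_integral_cong) (auto simp: indicator_def)
      also have "enn2real \<dots> = (\<integral>s. indicator {0..} s * ?T s \<partial>lborel)"
        using pos rx_tail_nonneg[of Pm \<Psi>]
        by (intro integral_eq_nn_integral[symmetric] has_bochner_integral_integrable AE_I2)
           (auto simp: indicator_def intro: borel_measurable_has_bochner_integral[OF T])
      finally show ?thesis
        using has_bochner_integral_integral_eq[OF T] by simp
    qed

    have I: "(\<integral>\<^sup>+\<omega>. ennreal (CI i \<omega>) \<partial>M) =
      (\<integral>\<^sup>+s\<in>{0..}. ennreal (?e * ?R s) \<partial>lborel) + (\<integral>\<^sup>+s\<in>{0..}. ennreal (?c * ?J s) \<partial>lborel)"
      using nn_integral_links[OF gains_indep i, of "\<lambda>(x, t, z). ennreal (capacity_I Pm Pn \<Psi> \<eta> x t z)"]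
      unfolding nn_integral_capacity_I[OF pos, symmetric] by (simp add: law CI_eq)
    have I_fin: "(\<integral>\<^sup>+\<omega>. ennreal (CI i \<omega>) \<partial>M) < \<infinity>"
      using CI_int CI_nonneg by (simp add: nn_integral_eq_integral)
    have J_nonneg: "indicator {0<..} s * ?J s \<ge> 0" for s
      using upper_Gamma_nonneg by (auto simp: indicator_def)
    have R_nonneg: "indicator {0..} s * ?R s \<ge> 0" for s
      using pos by (auto simp: indicator_def)
    \<comment> \<open>Passes to the open ray of the claim, which leaves out the singular point
      0.\<close>
    have J_nn: "(\<integral>\<^sup>+s\<in>{0..}. ennreal (?c * ?J s) \<partial>lborel) = (\<integral>\<^sup>+s. ennreal (?c * (indicator {0<..} s * ?J s)) \<partial>lborel)"
      by (rule nn_integral_cong_AE, rule AE_mp[OF AE_lborel_singleton[of 0]], intro AE_I2 impI)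
         (auto simp: indicator_def)
    have R_nn: "(\<integral>\<^sup>+s\<in>{0..}. ennreal (?e * ?R s) \<partial>lborel) = (\<integral>\<^sup>+s. ennreal (?e * (indicator {0..} s * ?R s)) \<partial>lborel)"
      by (intro nn_integral_cong) (auto simp: indicator_def)
    have cJ_nonneg: "?c * (indicator {0<..} s * ?J s) \<ge> 0" for s
      using less_imp_le[OF c(2)] J_nonneg by (rule mult_nonneg_nonneg)
    have eR_nonneg: "?e * (indicator {0..} s * ?R s) \<ge> 0" for s
      using c(1) R_nonneg by (rule mult_nonneg_nonneg)
    \<comment> \<open>By \<open>I_fin\<close> the two nonnegative integrals have a finite sum, so
      each of them is finite.\<close>
    have cJ_int: "integrable lborel (\<lambda>s. ?c * (indicator {0<..} s * ?J s))"
      using I_fin cJ_nonneg unfolding I J_nn by (intro integrableI_nonneg AE_I2) auto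
    have eR_int: "integrable lborel (\<lambda>s. ?e * (indicator {0..} s * ?R s))"
      using I_fin eR_nonneg unfolding I R_nn by (intro integrableI_nonneg AE_I2) auto
    have J_int: "integrable lborel (\<lambda>s. indicator {0<..} s * ?J s)"
    proof -
      have cancel: "1 / c * (c * x) = x" if "c > 0" for c x :: real
        using that by simp
      have "integrable lborel (\<lambda>s. 1 / ?c * (?c * (indicator {0<..} s * ?J s)))"
        by (rule integrable_mult_right) (rule cJ_int)
      then show ?thesis unfolding cancel[OF c(2)] .
    qed
    have "ennreal (expectation (CI i)) = (\<integral>\<^sup>+\<omega>. ennreal (CI i \<omega>) \<partial>M)"
      using CI_int CI_nonneg by (rule nn_integral_eq_integral[symmetric])
    also have "\<dots> = ennreal (\<integral>s. ?e * (indicator {0..} s * ?R s) \<partial>lborel) +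
        ennreal (\<integral>s. ?c * (indicator {0<..} s * ?J s) \<partial>lborel)"
      unfolding I J_nn R_nn
      by (intro arg_cong2[where f = "(+)"] nn_integral_eq_integral cJ_int eR_int AE_I2 cJ_nonneg eR_nonneg)
    also have "\<dots> = ennreal ((\<integral>s. ?e * (indicator {0..} s * ?R s) \<partial>lborel) +
        (\<integral>s. ?c * (indicator {0<..} s * ?J s) \<partial>lborel))"
      by (intro ennreal_plus[symmetric] Bochner_Integration.integral_nonneg cJ_nonneg eR_nonneg)
    finally have "expectation (CI i) = (\<integral>s. ?e * (indicator {0..} s * ?R s) \<partial>lborel) +
        (\<integral>s. ?c * (indicator {0<..} s * ?J s) \<partial>lborel)"
      by (subst (asm) ennreal_inj)
         (intro integral_nonneg_AE CI_nonneg add_nonneg_nonneg Bochner_Integration.integral_nonneg cJ_nonneg eR_nonneg)+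
    then have I_val: "expectation (CI i) = ?e * (\<integral>s. indicator {0..} s * ?R s \<partial>lborel) +
        ?c * (\<integral>s. indicator {0<..} s * ?J s \<partial>lborel)"
      by (simp only: integral_mult_right_zero)
    \<comment> \<open>Pm = Pn is excluded only here, for the closed form of the integral of
      \<open>?R\<close>; the Gamma integral stays as it is.\<close>
    have I_val': "expectation (CI i) = ?e / (1 - Pn / Pm) *
              (upper_Gamma 0 (\<eta> / Pm) * exp (\<eta> / Pm) - upper_Gamma 0 (\<eta> / Pn) * exp (\<eta> / Pn))
            + ?c * (LINT x:{0<..}|lborel. ?J x)" if ne: "Pm \<noteq> Pn"
      unfolding I_val has_bochner_integral_integral_eq[OF has_bochner_integral_partial_fraction[OF pos(1,2,4) ne]]
      by (simp add: set_lebesgue_integral_def)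
    show ?thesis
      using CI_int CNI_int J_int I_val' NI_val by (simp add: set_integrable_def)
  qed
  show ?thesis using part1 part2 by blast
qed

end
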